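(* Let $\sigma$ be an automorphism of an algebra $\mathcal{A}$ and let $(\mathcal{A},\mathfrak{H},D)$ be a graded $\sigma$-spectral triple, with grading operator $\gamma$, such that $D^{-1}\in\mathcal{L}^{n,\infty}$ for some even $n\in\mathbb{N}$. Then the multilinear form $$\Phi_{D,\sigma}(a^0,a^1,\ldots,a^n):=\mathrm{Tr}\big(\gamma\,D^{-1}d_\sigma a^0\;D^{-1}d_\sigma a^1\cdots D^{-1}d_\sigma a^n\big),\qquad a^0,\ldots,a^n\in\mathcal{A},$$ where $d_\sigma a=D\,a-\sigma(a)\,D$, is a cyclic cocycle in $Z^n_\lambda(\mathcal{A})$.
   Context: Let $\sigma$ be an automorphism of the algebra $\mathcal{A}$. A graded $\sigma$-spectral triple $(\mathcal{A},\mathfrak{H},D)$ is given by an action of $\mathcal{A}$ by bounded operators on a Hilbert space $\mathfrak{H}$, a self-adjoint operator $D$ on $\mathfrak{H}$ with compact resolvent such that $Da-\sigma(a)D$ is bounded for all $a\in\mathcal{A}$ (that is, $a$ preserves $\mathrm{Dom}(D)$ and $Da-\sigma(a)D$ extends to a bounded operator, denoted by the same expression), and a grading operator $\gamma=\gamma^*$, $\gamma^2=I$, which commutes with the action of $\mathcal{A}$ and satisfies $D\gamma=-\gamma D$. Writing $D^{-1}\in\mathcal{L}^{n,\infty}$ includes the assumption that $D$ is invertible; for $n>1$, $\mathcal{L}^{n,\infty}$ is the ideal of compact operators whose decreasing singular values satisfy $\mu_k(T)=O(k^{-1/n})$. $Z^n_\lambda(\mathcal{A})$ is the space of cyclic $n$-cocycles: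 $(n+1)$-linear forms $\Phi$ on $\mathcal{A}$ with $\Phi(a^n,a^0,\ldots,a^{n-1})=(-1)^n\Phi(a^0,\ldots,a^n)$ and $b\Phi=0$, where $b\Phi(a^0,\ldots,a^{n+1})=\sum_{i=0}^{n}(-1)^i\Phi(a^0,\ldots,a^ia^{i+1},\ldots,a^{n+1})+(-1)^{n+1}\Phi(a^{n+1}a^0,a^1,\ldots,a^n)$. *)

theory Defs
  imports "HOL-Analysis.Analysis" "HOL-Library.Landau_Symbols"
begin

section \<open>Complex vector spaces, algebras and Hilbert spaces\<close>

class complex_vector = ab_group_add +
  fixes scaleC :: "complex \<Rightarrow> 'a \<Rightarrow> 'a"  (infixr \<open>*\<^sub>C\<close> 75)
  assumes scaleC_add_right: "c *\<^sub>C (x + y) = c *\<^sub>C x + c *\<^sub>C y"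
    and scaleC_add_left: "(c + d) *\<^sub>C x = c *\<^sub>C x + d *\<^sub>C x"
    and scaleC_scaleC: "c *\<^sub>C d *\<^sub>C x = (c * d) *\<^sub>C x"
    and scaleC_one: "1 *\<^sub>C x = x"

interpretation complex_vector:
  vector_space "scaleC :: complex \<Rightarrow> 'a \<Rightarrow> 'a::complex_vector"
  by unfold_locales
    (simp_all add: scaleC_add_right scaleC_add_left scaleC_scaleC scaleC_one)

abbreviation clinear :: "('a::complex_vector \<Rightarrow> 'b::complex_vector) \<Rightarrow> bool" where
  "clinear \<equiv> Vector_Spaces.linear scaleC scaleC"

text \<open>Associative algebras, not assumed to have a unit.\<close>

class complex_algebra = complex_vector + ring +
  assumes mult_scaleC_left: "(c *\<^sub>C x) * y = c *\<^sub>C (x * y)"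
    and mult_scaleC_right: "x * (c *\<^sub>C y) = c *\<^sub>C (x * y)"

text \<open>The norm and the topology come from \<^class>\<open>real_inner\<close>, whose real inner product is the
  real part of the hermitian one; the latter is linear in its second argument.\<close>

class complex_hilbert = complex_vector + real_inner + complete_space +
  fixes cinner :: "'a \<Rightarrow> 'a \<Rightarrow> complex"
  assumes scaleR_scaleC: "r *\<^sub>R x = complex_of_real r *\<^sub>C x"
    and cinner_commute: "cinner x y = cnj (cinner y x)"
    and cinner_add_right: "cinner x (y + z) = cinner x y + cinner x z"
    and cinner_scaleC_right: "cinner x (c *\<^sub>C y) = c * cinner x y"
    and inner_eq_Re_cinner: "inner x y = Re (cinner x y)"

instantiation complex :: complex_hilbert
begin

definition scaleC_complex :: "complex \<Rightarrow> complex \<Rightarrow> complex" where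
  "scaleC_complex c x = c * x"

definition cinner_complex :: "complex \<Rightarrow> complex \<Rightarrow> complex" where
  "cinner_complex x y = cnj x * y"

instance
  by standard
    (simp_all add: scaleC_complex_def cinner_complex_def algebra_simps scaleR_conv_of_real
      inner_complex_def)

end

definition orthonormal_basis :: "'h::complex_hilbert set \<Rightarrow> bool" where
  "orthonormal_basis B \<longleftrightarrow>
     (\<forall>e\<in>B. \<forall>f\<in>B. cinner e f = (if e = f then 1 else 0)) \<and>
     closure (complex_vector.span B) = UNIV"


section \<open>Bounded and compact operators, singular values, trace\<close>

definition bounded_clinear :: "('h::complex_hilbert \<Rightarrow> 'h) \<Rightarrow> bool" where
  "bounded_clinear T \<longleftrightarrow> bounded_linear T \<and> clinear T"

definition compact_operator :: "('h::complex_hilbert \<Rightarrow> 'h) \<Rightarrow> bool" where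
  "compact_operator T \<longleftrightarrow> bounded_clinear T \<and> compact (closure (T ` cball 0 1))"

definition cadjoint :: "('h::complex_hilbert \<Rightarrow> 'h) \<Rightarrow> 'h \<Rightarrow> 'h" where
  "cadjoint T = (THE S. \<forall>x y. cinner (T x) y = cinner x (S y))"

text \<open>The sequence \<open>s\<close> lists, in decreasing order and with multiplicity, the square roots of the
  nonzero eigenvalues of \<open>T\<^sup>* T\<close>, i.e. the nonzero eigenvalues of \<open>\<bar>T\<bar>\<close>, followed
  by zeros if there are only finitely many of them. This determines \<open>s\<close>. It is only meant for compact \<open>T\<close>,
  where the eigenspaces in question are finite-dimensional (the library's \<open>dim\<close> of an
  infinite-dimensional space is \<open>0\<close>).\<close>

definition singular_values :: "('h::complex_hilbert \<Rightarrow> 'h) \<Rightarrow> (nat \<Rightarrow> real) \<Rightarrow> bool" where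
  "singular_values T s \<longleftrightarrow>
     decseq s \<and> s \<longlonglongrightarrow> 0 \<and>
     (\<forall>r>0. card {k. s k = r} =
        complex_vector.dim {x. cadjoint T (T x) = complex_of_real (r\<^sup>2) *\<^sub>C x})"

text \<open>The ideal \<open>\<L>\<^sup>(\<^sup>p\<^sup>,\<^sup>\<infinity>\<^sup>)\<close>, for \<open>p > 1\<close>.\<close>

definition weak_schatten :: "real \<Rightarrow> ('h::complex_hilbert \<Rightarrow> 'h) set" where
  "weak_schatten p =
     {T. compact_operator T \<and>
         (\<exists>s. singular_values T s \<and> s \<in> O(\<lambda>k. real k powr (- 1 / p)))}"

text \<open>The diagonal sum converges unconditionally, to the same value \<open>t\<close>, in every orthonormal basis.
  For a bounded operator this holds for some \<open>t\<close> exactly if the operator is trace class.\<close>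

definition has_trace :: "('h::complex_hilbert \<Rightarrow> 'h) \<Rightarrow> complex \<Rightarrow> bool" where
  "has_trace T t \<longleftrightarrow> bounded_clinear T \<and>
     (\<forall>B. orthonormal_basis B \<longrightarrow> ((\<lambda>e. cinner e (T e)) has_sum t) B)"

definition op_trace :: "('h::complex_hilbert \<Rightarrow> 'h) \<Rightarrow> complex" where
  "op_trace T = (THE t. has_trace T t)"


section \<open>Unbounded operators\<close>

text \<open>An unbounded operator is given by its domain \<open>X\<close> and a function \<open>D\<close> whose values outside
  \<open>X\<close> are irrelevant.\<close>

definition densely_defined :: "'h::complex_hilbert set \<Rightarrow> ('h \<Rightarrow> 'h) \<Rightarrow> bool" where
  "densely_defined X D \<longleftrightarrow>
     complex_vector.subspace X \<and> closure X = UNIV \<and>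
     (\<forall>x\<in>X. \<forall>y\<in>X. D (x + y) = D x + D y) \<and>
     (\<forall>c. \<forall>x\<in>X. D (c *\<^sub>C x) = c *\<^sub>C D x)"

text \<open>The left-hand side of the second conjunct says that \<open>(y, z)\<close> is in the graph of the adjoint
  of \<open>D\<close>, so that the conjunct says that \<open>D\<close> equals its adjoint, domains included.\<close>

definition selfadjoint_operator :: "'h::complex_hilbert set \<Rightarrow> ('h \<Rightarrow> 'h) \<Rightarrow> bool" where
  "selfadjoint_operator X D \<longleftrightarrow>
     densely_defined X D \<and>
     (\<forall>y z. (\<forall>x\<in>X. cinner (D x) y = cinner x z) \<longleftrightarrow> y \<in> X \<and> z = D y)"

definition resolvent :: "'h::complex_hilbert set \<Rightarrow> ('h \<Rightarrow> 'h) \<Rightarrow> complex \<Rightarrow> 'h \<Rightarrow> 'h" where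
  "resolvent X D c = the_inv_into X (\<lambda>x. D x - c *\<^sub>C x)"

definition resolvent_set :: "'h::complex_hilbert set \<Rightarrow> ('h \<Rightarrow> 'h) \<Rightarrow> complex set" where
  "resolvent_set X D =
     {c. bij_betw (\<lambda>x. D x - c *\<^sub>C x) X UNIV \<and> bounded_clinear (resolvent X D c)}"

text \<open>By the resolvent identity, compactness at one point of the resolvent set is equivalent to
  compactness at all of them.\<close>

definition compact_resolvent :: "'h::complex_hilbert set \<Rightarrow> ('h \<Rightarrow> 'h) \<Rightarrow> bool" where
  "compact_resolvent X D \<longleftrightarrow> (\<exists>c\<in>resolvent_set X D. compact_operator (resolvent X D c))"


section \<open>Graded \<open>\<sigma>\<close>-spectral triples\<close>

definition algebra_automorphism :: "('a::complex_algebra \<Rightarrow> 'a) \<Rightarrow> bool" where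
  "algebra_automorphism \<sigma> \<longleftrightarrow>
     bij \<sigma> \<and> clinear \<sigma> \<and> (\<forall>a b. \<sigma> (a * b) = \<sigma> a * \<sigma> b)"

definition algebra_action :: "('a::complex_algebra \<Rightarrow> 'h::complex_hilbert \<Rightarrow> 'h) \<Rightarrow> bool" where
  "algebra_action \<pi> \<longleftrightarrow>
     (\<forall>a. bounded_clinear (\<pi> a)) \<and>
     (\<forall>a b x. \<pi> (a + b) x = \<pi> a x + \<pi> b x) \<and>
     (\<forall>c a x. \<pi> (c *\<^sub>C a) x = c *\<^sub>C \<pi> a x) \<and>
     (\<forall>a b x. \<pi> (a * b) x = \<pi> a (\<pi> b x))"

text \<open>\<open>T\<close> is a bounded extension of \<open>D a - \<sigma>(a) D\<close>, which is defined on \<open>X\<close>.\<close>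

definition twisted_commutator_ext ::
  "('a::complex_algebra \<Rightarrow> 'a) \<Rightarrow> ('a \<Rightarrow> 'h::complex_hilbert \<Rightarrow> 'h) \<Rightarrow>
   'h set \<Rightarrow> ('h \<Rightarrow> 'h) \<Rightarrow> 'a \<Rightarrow> ('h \<Rightarrow> 'h) \<Rightarrow> bool" where
  "twisted_commutator_ext \<sigma> \<pi> X D a T \<longleftrightarrow>
     bounded_clinear T \<and> (\<forall>x\<in>X. T x = D (\<pi> a x) - \<pi> (\<sigma> a) (D x))"

definition d_sigma ::
  "('a::complex_algebra \<Rightarrow> 'a) \<Rightarrow> ('a \<Rightarrow> 'h::complex_hilbert \<Rightarrow> 'h) \<Rightarrow>
   'h set \<Rightarrow> ('h \<Rightarrow> 'h) \<Rightarrow> 'a \<Rightarrow> 'h \<Rightarrow> 'h" where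
  "d_sigma \<sigma> \<pi> X D a = (THE T. twisted_commutator_ext \<sigma> \<pi> X D a T)"

locale graded_sigma_spectral_triple =
  fixes \<sigma> :: "'a::complex_algebra \<Rightarrow> 'a"
    and \<pi> :: "'a \<Rightarrow> 'h::complex_hilbert \<Rightarrow> 'h"
    and X :: "'h set" and D :: "'h \<Rightarrow> 'h"
    and \<gamma> :: "'h \<Rightarrow> 'h"
  assumes automorphism: "algebra_automorphism \<sigma>"
    and action: "algebra_action \<pi>"
    and selfadjoint: "selfadjoint_operator X D"
    and compact_resolvent: "compact_resolvent X D"
    and preserves_domain: "x \<in> X \<Longrightarrow> \<pi> a x \<in> X"
    and bounded_twisted_commutator: "\<exists>T. twisted_commutator_ext \<sigma> \<pi> X D a T"
    and grading_bounded: "bounded_clinear \<gamma>"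
    and grading_selfadjoint: "cinner (\<gamma> x) y = cinner x (\<gamma> y)"
    and grading_involution: "\<gamma> (\<gamma> x) = x"
    and grading_commutes: "\<gamma> (\<pi> a x) = \<pi> a (\<gamma> x)"
    and grading_domain: "x \<in> X \<Longrightarrow> \<gamma> x \<in> X"
    and grading_anticommutes: "x \<in> X \<Longrightarrow> D (\<gamma> x) = - \<gamma> (D x)"


section \<open>Cyclic cocycles\<close>

text \<open>The tuple \<open>(a\<^sup>0, \<dots>, a\<^sup>n)\<close> is a list of length \<open>n + 1\<close>; values of a form on lists of other
  lengths are irrelevant.\<close>

definition multilinear_form :: "nat \<Rightarrow> ('a::complex_algebra list \<Rightarrow> complex) \<Rightarrow> bool" where
  "multilinear_form m \<Phi> \<longleftrightarrow>
     (\<forall>as i. length as = m \<and> i < m \<longrightarrow> clinear (\<lambda>x. \<Phi> (as[i := x])))"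

definition hochschild_b ::
  "nat \<Rightarrow> ('a::complex_algebra list \<Rightarrow> complex) \<Rightarrow> 'a list \<Rightarrow> complex" where
  "hochschild_b n \<Phi> as =
     (\<Sum>i=0..n. (-1) ^ i * \<Phi> (take i as @ [as ! i * as ! (i + 1)] @ drop (i + 2) as))
     + (-1) ^ (n + 1) * \<Phi> ([as ! (n + 1) * as ! 0] @ take n (tl as))"

definition cyclic_cocycles :: "nat \<Rightarrow> ('a::complex_algebra list \<Rightarrow> complex) set" where
  "cyclic_cocycles n =
     {\<Phi>. multilinear_form (n + 1) \<Phi> \<and>
         (\<forall>as. length as = n + 1 \<longrightarrow> \<Phi> (last as # butlast as) = (-1) ^ n * \<Phi> as) \<and>
         (\<forall>as. length as = n + 2 \<longrightarrow> hochschild_b n \<Phi> as = 0)}"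

text \<open>The operator \<open>\<gamma> D\<^sup>-\<^sup>1 d\<^sub>\<sigma>a\<^sup>0 \<cdots> D\<^sup>-\<^sup>1 d\<^sub>\<sigma>a\<^sup>n\<close>.\<close>

definition character_operator ::
  "('a::complex_algebra \<Rightarrow> 'a) \<Rightarrow> ('a \<Rightarrow> 'h::complex_hilbert \<Rightarrow> 'h) \<Rightarrow>
   'h set \<Rightarrow> ('h \<Rightarrow> 'h) \<Rightarrow> ('h \<Rightarrow> 'h) \<Rightarrow> 'a list \<Rightarrow> 'h \<Rightarrow> 'h" where
  "character_operator \<sigma> \<pi> X D \<gamma> as =
     \<gamma> \<circ> foldr (\<lambda>a T. the_inv_into X D \<circ> d_sigma \<sigma> \<pi> X D a \<circ> T) as id"

definition Phi_D_sigma ::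
  "('a::complex_algebra \<Rightarrow> 'a) \<Rightarrow> ('a \<Rightarrow> 'h::complex_hilbert \<Rightarrow> 'h) \<Rightarrow>
   'h set \<Rightarrow> ('h \<Rightarrow> 'h) \<Rightarrow> ('h \<Rightarrow> 'h) \<Rightarrow> 'a list \<Rightarrow> complex" where
  "Phi_D_sigma \<sigma> \<pi> X D \<gamma> as = op_trace (character_operator \<sigma> \<pi> X D \<gamma> as)"

end

theory Submission
  imports Defs
begin

text \<open>
  Write \<open>T = D\<^sup>-\<^sup>1\<close>, a compact self-adjoint operator. Cutting off its spectrum shows that its
  approximation numbers are \<open>O(k\<^sup>-\<^sup>1\<^sup>/\<^sup>n)\<close>. Approximation numbers are submultiplicative, so those of a
  product of \<open>n + 1\<close> factors \<open>T S\<^sub>i\<close> with \<open>S\<^sub>i\<close> bounded are \<open>O(k\<^sup>-\<^sup>(\<^sup>n\<^sup>+\<^sup>1\<^sup>)\<^sup>/\<^sup>n)\<close>, hence summable. A dyadic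
  decomposition turns such an operator into an absolutely convergent sum of operators of rank one,
  for which the diagonal sum is the same in all orthonormal bases and \<open>Tr (S N) = Tr (N S)\<close> holds for
  bounded \<open>S\<close>. If \<open>T S\<close> and \<open>S T\<close> both have a trace, then \<open>Tr (T S) = Tr (S T)\<close> because the two diagonals
  agree in an eigenbasis of \<open>T\<close>; this gives cyclicity, as \<open>\<gamma>\<close> commutes with \<open>T d\<^sub>\<sigma>a\<close>.

  For the cocycle identity, \<open>T d\<^sub>\<sigma>a = \<pi>(a) - \<rho>(a)\<close> where \<open>\<rho>(a) = T \<pi>(\<sigma>(a)) D\<close>, so that
  \<open>T d\<^sub>\<sigma>(a b) = T d\<^sub>\<sigma>a \<pi>(b) + \<rho>(a) T d\<^sub>\<sigma>b\<close>. Inserting this, the Hochschild coboundary telescopes.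
\<close>

section \<open>Bounded operators on complex Hilbert spaces\<close>

lemma clinear_iff:
  "clinear f \<longleftrightarrow> (\<forall>x y. f (x + y) = f x + f y) \<and> (\<forall>c x. f (c *\<^sub>C x) = c *\<^sub>C f x)"
  by (simp add: Vector_Spaces.linear_iff complex_vector.vector_space_axioms)

lemma scaleC_complex_eq [simp]: "c *\<^sub>C (x::complex) = c * x"
  by (simp add: scaleC_complex_def)

lemma cinner_add_left: "cinner (x + y) z = cinner x z + cinner y z"
  by (metis cinner_add_right cinner_commute complex_cnj_add)

lemma cinner_scaleC_left: "cinner (c *\<^sub>C x) y = cnj c * cinner x y"
  by (metis cinner_scaleC_right cinner_commute complex_cnj_mult)

lemma cinner_zero [simp]: "cinner x 0 = 0" "cinner 0 x = 0"
  using cinner_add_right[of x 0 0] cinner_add_left[of 0 0 x] by simp_all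

lemma cinner_minus_right: "cinner x (- y) = - cinner x y"
  by (metis add.right_inverse add_eq_0_iff cinner_add_right cinner_zero(1))

lemma cinner_minus_left: "cinner (- x) y = - cinner x y"
  by (metis cinner_minus_right cinner_commute complex_cnj_minus)

lemma cinner_diff_right: "cinner x (y - z) = cinner x y - cinner x z"
  using cinner_add_right[of x y "- z"] by (simp add: cinner_minus_right)

lemma cinner_diff_left: "cinner (x - y) z = cinner x z - cinner y z"
  using cinner_add_left[of x "- y" z] by (simp add: cinner_minus_left)

lemma cinner_sum_right: "cinner x (sum f A) = (\<Sum>a\<in>A. cinner x (f a))"
  by (induction A rule: infinite_finite_induct) (simp_all add: cinner_add_right)

lemma cinner_sum_left: "cinner (sum f A) x = (\<Sum>a\<in>A. cinner (f a) x)"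
  by (induction A rule: infinite_finite_induct) (simp_all add: cinner_add_left)

lemmas cinner_simps = cinner_add_left cinner_add_right cinner_diff_left cinner_diff_right
  cinner_minus_left cinner_minus_right cinner_scaleC_left cinner_scaleC_right

lemma cinner_self: "cinner x x = complex_of_real ((norm x)\<^sup>2)"
proof (rule complex_eqI)
  show "Re (cinner x x) = Re (complex_of_real ((norm x)\<^sup>2))"
    by (simp add: inner_eq_Re_cinner [symmetric] power2_norm_eq_inner)
  have "cnj (cinner x x) = cinner x x" by (rule cinner_commute [symmetric])
  then show "Im (cinner x x) = Im (complex_of_real ((norm x)\<^sup>2))"
    by (metis Im_complex_of_real cnj.simps(2) equal_neg_zero)
qed

lemma cinner_self_eq_0 [simp]: "cinner x x = 0 \<longleftrightarrow> x = 0"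
  by (simp add: cinner_self)

lemma norm_scaleC: "norm (c *\<^sub>C (x::'h::complex_hilbert)) = cmod c * norm x"
proof -
  have "complex_of_real ((norm (c *\<^sub>C x))\<^sup>2) = complex_of_real ((cmod c * norm x)\<^sup>2)"
    by (simp only: cinner_self [symmetric] cinner_simps)
      (simp add: cinner_self power_mult_distrib complex_norm_square[symmetric] mult.assoc[symmetric])
  then show ?thesis
    by (simp only: of_real_eq_iff) (simp add: power2_eq_iff_nonneg)
qed

text \<open>This removes phases: it reduces the hermitian Cauchy-Schwarz inequality to the real one
  and later aligns the summands of a series.\<close>

lemma cmod_unimodular: obtains u where "cmod u = 1" "u * z = complex_of_real (cmod z)"
proof (cases "z = 0")
  case False
  then have "cmod (cnj z / cmod z) = 1" "cnj z / cmod z * z = cmod z"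
    using complex_norm_square[of z]
    by (simp_all add: norm_divide field_simps power2_eq_square)
  then show ?thesis using that by blast
qed (use that[of 1] in simp)

lemma norm_cinner_le: "cmod (cinner x y) \<le> norm x * norm y"
proof -
  obtain u where u: "cmod u = 1" "u * cinner x y = complex_of_real (cmod (cinner x y))"
    using cmod_unimodular by blast
  have "cmod (cinner x y) = inner x (u *\<^sub>C y)"
    by (simp add: inner_eq_Re_cinner cinner_simps u)
  also have "\<dots> \<le> norm x * norm (u *\<^sub>C y)" by (rule norm_cauchy_schwarz)
  finally show ?thesis by (simp add: norm_scaleC u)
qed

lemma bounded_linear_cinner_right: "bounded_linear (cinner x)"
  by (rule bounded_linear_intro[where K = "norm x"])
    (simp_all add: cinner_simps scaleR_scaleC[where 'a = 'a] norm_cinner_le mult.commute[of _ "norm x"] scaleR_conv_of_real)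

lemma cinner_ext: "(\<And>z. cinner z x = cinner z y) \<Longrightarrow> x = y"
  by (metis cinner_diff_right cinner_self_eq_0 eq_iff_diff_eq_0)

lemma bounded_clinearI:
  fixes T :: "'h::complex_hilbert \<Rightarrow> 'h"
  assumes "\<And>x y. T (x + y) = T x + T y" "\<And>c x. T (c *\<^sub>C x) = c *\<^sub>C T x"
    and "\<And>x. norm (T x) \<le> K * norm x"
  shows "bounded_clinear T"
  unfolding bounded_clinear_def clinear_iff
  using assms by (auto intro!: bounded_linear_intro[where K = K] simp: scaleR_scaleC mult.commute[of _ K])

lemma
  assumes "bounded_clinear T"
  shows bounded_clinear_add: "T (x + y) = T x + T y"
    and bounded_clinear_scaleC: "T (c *\<^sub>C x) = c *\<^sub>C T x"
    and bounded_clinear_zero: "T 0 = 0"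
    and bounded_clinear_diff: "T (x - y) = T x - T y"
    and bounded_clinear_minus: "T (- x) = - T x"
    and bounded_clinear_sum: "T (sum f A) = (\<Sum>a\<in>A. T (f a))"
    and bounded_clinear_bounded_linear: "bounded_linear T"
proof -
  show b: "bounded_linear T" using assms by (simp add: bounded_clinear_def)
  interpret bounded_linear T by (rule b)
  show "T (x + y) = T x + T y" "T 0 = 0" "T (x - y) = T x - T y" "T (- x) = - T x"
    "T (sum f A) = (\<Sum>a\<in>A. T (f a))"
    by (simp_all add: add zero diff neg sum)
  show "T (c *\<^sub>C x) = c *\<^sub>C T x" using assms by (simp add: bounded_clinear_def clinear_iff)
qed

lemmas bounded_clinear_simps = bounded_clinear_add bounded_clinear_scaleC bounded_clinear_zero
  bounded_clinear_diff bounded_clinear_minus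

lemma bounded_clinear_bound:
  assumes "bounded_clinear T"
  obtains K where "K > 0" "\<And>x. norm (T x) \<le> K * norm x"
  using bounded_linear.pos_bounded[OF bounded_clinear_bounded_linear[OF assms]]
  by (metis mult.commute)

lemma bounded_clinear_compose:
  assumes "bounded_clinear S" "bounded_clinear T"
  shows "bounded_clinear (S \<circ> T)"
  unfolding bounded_clinear_def clinear_iff
  using bounded_linear_compose[OF bounded_clinear_bounded_linear[OF assms(1)] bounded_clinear_bounded_linear[OF assms(2)]]
  by (simp add: bounded_clinear_simps[OF assms(1)] bounded_clinear_simps[OF assms(2)] o_def)

lemma bounded_clinear_plus:
  assumes "bounded_clinear S" "bounded_clinear T"
  shows "bounded_clinear (\<lambda>x. S x + T x)"
  unfolding bounded_clinear_def clinear_iff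
  using bounded_linear_add[OF bounded_clinear_bounded_linear[OF assms(1)] bounded_clinear_bounded_linear[OF assms(2)]]
  by (simp add: bounded_clinear_simps[OF assms(1)] bounded_clinear_simps[OF assms(2)] scaleC_add_right algebra_simps)

lemma bounded_clinear_scale:
  assumes "bounded_clinear T"
  shows "bounded_clinear (\<lambda>x. c *\<^sub>C T x)"
proof -
  obtain K where K: "\<And>x. norm (T x) \<le> K * norm x" using bounded_clinear_bound[OF assms] by blast
  show ?thesis
    by (rule bounded_clinearI[where K = "cmod c * K"])
      (simp_all add: bounded_clinear_simps[OF assms] scaleC_add_right scaleC_scaleC mult.commute[of c]
         norm_scaleC mult.assoc mult_left_mono[OF K])
qed

lemma bounded_clinear_minus_op:
  assumes "bounded_clinear S" "bounded_clinear T"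
  shows "bounded_clinear (\<lambda>x. S x - T x)"
  using bounded_clinear_plus[OF assms(1) bounded_clinear_scale[OF assms(2), of "-1"]]
  by (simp add: scaleC_one)

lemma bounded_clinear_0: "bounded_clinear (\<lambda>x. 0)"
  by (rule bounded_clinearI[where K = 0]) simp_all

lemma bounded_clinear_id: "bounded_clinear id"
  by (rule bounded_clinearI[where K = 1]) simp_all

section \<open>Finite orthonormal sets\<close>

definition orthonormal :: "'h::complex_hilbert set \<Rightarrow> bool" where
  "orthonormal B \<longleftrightarrow> (\<forall>e\<in>B. \<forall>f\<in>B. cinner e f = (if e = f then 1 else 0))"

text \<open>For finite orthonormal \<open>A\<close> this is the orthogonal projection onto the span
  of \<open>A\<close>; for infinite \<open>A\<close> the sum is 0 by default.\<close>

definition proj :: "'h::complex_hilbert set \<Rightarrow> 'h \<Rightarrow> 'h" where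
  "proj A x = (\<Sum>e\<in>A. cinner e x *\<^sub>C e)"

lemma orthonormal_mono: "orthonormal B \<Longrightarrow> A \<subseteq> B \<Longrightarrow> orthonormal A"
  unfolding orthonormal_def by (meson subsetD)

lemma orthonormal_norm: "orthonormal B \<Longrightarrow> e \<in> B \<Longrightarrow> norm e = 1"
  using cinner_self[of e] norm_ge_zero[of e]
  by (simp add: orthonormal_def power2_eq_1_iff flip: of_real_power)

lemma orthonormal_insert:
  assumes "orthonormal A" "norm v = 1" "\<And>e. e \<in> A \<Longrightarrow> cinner e v = 0"
  shows "orthonormal (insert v A)" "v \<notin> A"
proof -
  have "cinner v e = 0" if "e \<in> A" for e
    using assms(3)[OF that] by (metis cinner_commute complex_cnj_zero)
  moreover have "cinner v v = 1" using assms(2) by (simp add: cinner_self)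
  ultimately show "orthonormal (insert v A)" "v \<notin> A"
    using assms(1,3) by (auto simp: orthonormal_def)
qed

lemma proj_in_span: "proj A x \<in> complex_vector.span A"
  unfolding proj_def by (intro complex_vector.span_sum complex_vector.span_scale complex_vector.span_base)

lemma cinner_proj:
  assumes "orthonormal A" "finite A" "f \<in> A"
  shows "cinner f (proj A x) = cinner f x"
proof -
  have "cinner f (proj A x) = (\<Sum>e\<in>A. if e = f then cinner e x else 0)"
    using assms(1,3) unfolding proj_def cinner_sum_right
    by (intro sum.cong) (auto simp: cinner_simps orthonormal_def)
  then show ?thesis using assms by simp
qed

lemma cinner_diff_proj:
  assumes "orthonormal A" "finite A" "f \<in> A"
  shows "cinner f (x - proj A x) = 0"
  by (simp add: cinner_diff_right cinner_proj[OF assms])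

lemma cinner_span_zero:
  assumes "y \<in> complex_vector.span A" "\<And>e. e \<in> A \<Longrightarrow> cinner e x = 0"
  shows "cinner y x = 0"
  using assms(1)
  by (induction rule: complex_vector.span_induct_alt) (simp_all add: cinner_simps assms(2))

text \<open>The remainder \<open>x - proj A x\<close> lies in the span and is orthogonal to it,
  hence to itself.\<close>

lemma proj_eq:
  assumes "orthonormal A" "finite A" "x \<in> complex_vector.span A"
  shows "proj A x = x"
proof -
  have "x - proj A x \<in> complex_vector.span A"
    using assms(3) proj_in_span by (rule complex_vector.span_diff)
  then have "cinner (x - proj A x) (x - proj A x) = 0"
    using cinner_diff_proj[OF assms(1,2)] by (rule cinner_span_zero)
  then show ?thesis by simp
qed

lemma norm_add_orthogonal:
  assumes "cinner x y = 0"
  shows "(norm (x + y))\<^sup>2 = (norm x)\<^sup>2 + (norm y)\<^sup>2"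
proof -
  have "cinner y x = 0" using assms by (metis cinner_commute complex_cnj_zero)
  then have "complex_of_real ((norm (x + y))\<^sup>2) = complex_of_real ((norm x)\<^sup>2 + (norm y)\<^sup>2)"
    using assms by (simp only: cinner_self[symmetric] of_real_add cinner_simps) simp
  then show ?thesis by (simp only: of_real_eq_iff)
qed

text \<open>\<open>x - proj A x\<close> is orthogonal to the span of \<open>A\<close>, in which
  \<open>proj A x - y\<close> lies.\<close>

lemma norm_proj_pythagoras:
  assumes "orthonormal A" "finite A" "y \<in> complex_vector.span A"
  shows "(norm (x - y))\<^sup>2 = (norm (x - proj A x))\<^sup>2 + (norm (proj A x - y))\<^sup>2"
proof -
  have "proj A x - y \<in> complex_vector.span A"
    using proj_in_span assms(3) by (rule complex_vector.span_diff)
  then have "cinner (proj A x - y) (x - proj A x) = 0"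
    using cinner_diff_proj[OF assms(1,2)] by (rule cinner_span_zero)
  then show ?thesis using norm_add_orthogonal[of "proj A x - y" "x - proj A x"] by simp
qed

text \<open>Each bound drops one of the two squares in the Pythagorean identity, the last two with
  \<open>y = 0\<close>.\<close>

lemma
  assumes "orthonormal A" "finite A"
  shows norm_diff_proj_le: "y \<in> complex_vector.span A \<Longrightarrow> norm (x - proj A x) \<le> norm (x - y)"
    and norm_diff_proj_le': "norm (x - proj A x) \<le> norm x"
    and norm_proj_le: "norm (proj A x) \<le> norm x"
proof -
  show "norm (x - proj A x) \<le> norm (x - y)" if "y \<in> complex_vector.span A" for y
    using norm_proj_pythagoras[OF assms that, of x] by (simp add: power2_le_imp_le)
  then show "norm (x - proj A x) \<le> norm x"
    using complex_vector.span_zero by force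
  show "norm (proj A x) \<le> norm x"
    using norm_proj_pythagoras[OF assms complex_vector.span_zero, of x] by (simp add: power2_le_imp_le)
qed

lemma orthonormal_independent:
  assumes "orthonormal A"
  shows "complex_vector.independent A"
  unfolding complex_vector.dependent_explicit
proof safe
  fix t u v assume t: "finite t" "t \<subseteq> A" "(\<Sum>v\<in>t. u v *\<^sub>C v) = 0" and v: "v \<in> t" "u v \<noteq> 0"
  have "cinner v w = (if w = v then 1 else 0)" if "w \<in> t" for w
    using assms t(2) v(1) that unfolding orthonormal_def by (metis subsetD)
  then have "cinner v (\<Sum>w\<in>t. u w *\<^sub>C w) = (\<Sum>w\<in>t. if w = v then u w else 0)"
    unfolding cinner_sum_right
    by (intro sum.cong) (auto simp: cinner_simps)
  then show False using t v by simp
qed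

text \<open>Gram-Schmidt: each vector adds at most one normalized remainder, and a zero remainder
  adds none, so the cardinality does not grow.\<close>

lemma orthonormal_spanning_exists:
  assumes "finite (A :: 'h::complex_hilbert set)"
  shows "\<exists>B. orthonormal B \<and> finite B \<and> card B \<le> card A \<and> A \<subseteq> complex_vector.span B"
  using assms
proof (induction A rule: finite_induct)
  case empty
  then show ?case by (auto intro!: exI[of _ "{}"] simp: orthonormal_def)
next
  case (insert v A)
  then obtain B where B: "orthonormal B" "finite B" "card B \<le> card A" "A \<subseteq> complex_vector.span B"
    by blast
  define w where "w = v - proj B v"
  have v: "v = proj B v + w" by (simp add: w_def)
  show ?case
  proof (cases "w = 0")
    case True
    then have "v \<in> complex_vector.span B" using v proj_in_span[of B v] by simp
    then show ?thesis using B insert.hyps by (intro exI[of _ B]) auto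
  next
    case False
    define e where "e = complex_of_real (1 / norm w) *\<^sub>C w"
    have ne: "norm e = 1" using False by (simp add: e_def norm_scaleC norm_divide)
    have oe: "cinner f e = 0" if "f \<in> B" for f
      using cinner_diff_proj[OF B(1,2) that] by (simp add: e_def w_def cinner_scaleC_right)
    have we: "w = complex_of_real (norm w) *\<^sub>C e"
      using False by (simp add: e_def scaleC_scaleC scaleC_one flip: of_real_mult)
    have sub: "complex_vector.span B \<subseteq> complex_vector.span (insert e B)"
      by (rule complex_vector.span_mono) blast
    have "w \<in> complex_vector.span (insert e B)"
      by (subst we) (intro complex_vector.span_scale complex_vector.span_base insertI1)
    then have "v \<in> complex_vector.span (insert e B)"
      using v sub proj_in_span[of B v] complex_vector.span_add by (metis subsetD)
    then show ?thesis
      using orthonormal_insert[OF B(1) ne oe] B sub insert.hyps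
      by (intro exI[of _ "insert e B"]) auto
  qed
qed

section \<open>Orthonormal bases\<close>

lemma orthonormal_basis_iff:
  "orthonormal_basis B \<longleftrightarrow> orthonormal B \<and> closure (complex_vector.span B) = UNIV"
  by (simp add: orthonormal_basis_def orthonormal_def)

lemma span_finite_subset:
  assumes "y \<in> complex_vector.span B"
  obtains F where "finite F" "F \<subseteq> B" "y \<in> complex_vector.span F"
proof -
  obtain F u where F: "finite F" "F \<subseteq> B" "y = (\<Sum>v\<in>F. u v *\<^sub>C v)"
    using assms unfolding complex_vector.span_explicit by blast
  have "y \<in> complex_vector.span F"
    unfolding F(3) by (intro complex_vector.span_sum complex_vector.span_scale complex_vector.span_base)
  then show ?thesis using that F by blast
qed

text \<open>Density gives some \<open>y\<close> near \<open>x\<close> in the span of a finite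
  \<open>F\<close>. Partial sums are best approximations, so every finite set containing
  \<open>F\<close> does at least as well; this is unconditional convergence.\<close>

lemma orthonormal_basis_expansion:
  assumes "orthonormal_basis B"
  shows "((\<lambda>e. cinner e x *\<^sub>C e) has_sum x) B"
  unfolding has_sum_def tendsto_iff eventually_finite_subsets_at_top
proof (intro allI impI)
  fix \<epsilon> :: real assume "\<epsilon> > 0"
  have B: "orthonormal B" "closure (complex_vector.span B) = UNIV"
    using assms by (auto simp: orthonormal_basis_iff)
  obtain y where y: "y \<in> complex_vector.span B" "dist y x < \<epsilon>"
    using \<open>\<epsilon> > 0\<close> B(2) closure_approachable[of x "complex_vector.span B"] by auto
  obtain F where F: "finite F" "F \<subseteq> B" "y \<in> complex_vector.span F"
    using span_finite_subset[OF y(1)] .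
  have "dist (sum (\<lambda>e. cinner e x *\<^sub>C e) G) x < \<epsilon>" if "finite G" "F \<subseteq> G" "G \<subseteq> B" for G
  proof -
    have "y \<in> complex_vector.span G" using F(3) complex_vector.span_mono[OF that(2)] by blast
    then have "norm (x - proj G x) \<le> norm (x - y)"
      using norm_diff_proj_le orthonormal_mono[OF B(1) that(3)] that(1) by blast
    then show ?thesis using y(2) by (simp add: proj_def dist_norm norm_minus_commute)
  qed
  then show "\<exists>X. finite X \<and> X \<subseteq> B \<and>
      (\<forall>Y. finite Y \<and> X \<subseteq> Y \<and> Y \<subseteq> B \<longrightarrow> dist (sum (\<lambda>e. cinner e x *\<^sub>C e) Y) x < \<epsilon>)"
    using F by blast
qed

section \<open>Compact symmetric operators\<close>

locale compact_symmetric =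
  fixes T :: "'h::complex_hilbert \<Rightarrow> 'h"
  assumes compact: "compact_operator T"
    and symmetric: "cinner (T x) y = cinner x (T y)"
begin

definition eigenvectors :: "real \<Rightarrow> 'h set \<Rightarrow> bool" where
  "eigenvectors r A \<longleftrightarrow> (\<forall>e\<in>A. \<exists>l. T e = complex_of_real l *\<^sub>C e \<and> \<bar>l\<bar> > r)"

lemma bounded_clinear: "bounded_clinear T"
  using compact by (simp add: compact_operator_def)

lemmas T_simps = bounded_clinear_simps[OF bounded_clinear]

lemma T_scaleR: "T (a *\<^sub>R x) = a *\<^sub>R T x"
  by (simp add: scaleR_scaleC T_simps)

lemma inner_symmetric: "inner (T x) y = inner x (T y)"
  by (simp add: inner_eq_Re_cinner symmetric)

lemma tendsto_T: "(f \<longlongrightarrow> y) F \<Longrightarrow> ((\<lambda>n. T (f n)) \<longlongrightarrow> T y) F"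
  by (rule bounded_linear.tendsto[OF bounded_clinear_bounded_linear[OF bounded_clinear]])

text \<open>Symmetry moves \<open>T\<close> onto the eigenvector. The search for further
  eigenvectors can therefore stay inside the orthogonal complement of \<open>A\<close>.\<close>

lemma cinner_eigenvectors_T:
  assumes "eigenvectors r A" "\<And>e. e \<in> A \<Longrightarrow> cinner e x = 0" "e \<in> A"
  shows "cinner e (T x) = 0"
proof -
  obtain l where "T e = complex_of_real l *\<^sub>C e" using assms(1,3) by (auto simp: eigenvectors_def)
  then show ?thesis using assms(2,3) by (simp add: symmetric[symmetric] cinner_simps)
qed

text \<open>A maximizing sequence for \<open>\<parallel>T x\<parallel>\<close> on the unit ball of \<open>A\<^sup>\<bottom>\<close> is asymptotically an eigenvector
  of \<open>T\<^sup>2\<close>, and compactness turns it into a convergent one.\<close>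

lemma square_eigenvector_exists:
  assumes A: "eigenvectors r' A" and r: "r \<ge> 0"
    and x: "\<And>e. e \<in> A \<Longrightarrow> cinner e x = 0" "norm (T x) > r * norm x"
  shows "\<exists>z M. z \<noteq> 0 \<and> M > r \<and> T (T z) = M\<^sup>2 *\<^sub>R z \<and> (\<forall>e\<in>A. cinner e z = 0)"
proof -
  \<comment> \<open>\<open>V\<close> is the orthogonal complement of \<open>A\<close>, and
    \<open>M\<close> will be the norm of \<open>T\<close> restricted to \<open>V\<close>.\<close>
  define V where "V = {x. \<forall>e\<in>A. cinner e x = 0}"
  define S where "S = (\<lambda>x. norm (T x)) ` (V \<inter> cball 0 1)"
  define M where "M = Sup S"
  obtain K where K: "K > 0" "\<And>x. norm (T x) \<le> K * norm x"
    using bounded_clinear_bound[OF bounded_clinear] by blast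
  have S: "s \<le> K" if s: "s \<in> S" for s
  proof -
    obtain x where x: "s = norm (T x)" "norm x \<le> 1" using s by (auto simp: S_def)
    have "K * norm x \<le> K * 1" using x K(1) by (intro mult_left_mono) auto
    then show ?thesis using K(2)[of x] x by simp
  qed
  then have bdd: "bdd_above S" by (auto simp: bdd_above_def)
  have V_scale: "a *\<^sub>R x \<in> V" if "x \<in> V" for a x
    using that by (simp add: V_def scaleR_scaleC cinner_simps)
  have V_T: "T x \<in> V" if "x \<in> V" for x
    using cinner_eigenvectors_T[OF A] that by (auto simp: V_def)
  have le: "norm (T x) \<le> M * norm x" if "x \<in> V" for x
  proof (cases "x = 0")
    case False
    have "norm (T ((1 / norm x) *\<^sub>R x)) \<in> S"
      unfolding S_def using V_scale[OF that] False by (intro imageI) auto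
    then have "norm (T ((1 / norm x) *\<^sub>R x)) \<le> M"
      unfolding M_def using bdd by (rule cSup_upper)
    then show ?thesis using False by (simp add: T_scaleR field_simps)
  qed (simp add: T_simps)
  have "x \<in> V" using x(1) by (simp add: V_def)
  have "x \<noteq> 0" using x(2) by (auto simp: T_simps)
  have "M > r"
    using le[OF \<open>x \<in> V\<close>] x(2) \<open>x \<noteq> 0\<close>
    by (metis less_le_trans mult_less_cancel_right_pos zero_less_norm_iff)
  then have "M > 0" using r by simp
  have "S \<noteq> {}" using V_scale[OF \<open>x \<in> V\<close>, of 0] by (auto simp: S_def)
  have "\<exists>x. x \<in> V \<and> norm x \<le> 1 \<and> norm (T x) > M - 1 / real (Suc n)" for n
  proof -
    have "M - 1 / real (Suc n) < Sup S" by (simp add: M_def)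
    then show ?thesis
      using less_cSup_iff[OF \<open>S \<noteq> {}\<close> bdd] by (auto simp: S_def)
  qed
  then obtain f where f: "\<And>n. f n \<in> V" "\<And>n. norm (f n) \<le> 1" "\<And>n. norm (T (f n)) > M - 1 / real (Suc n)"
    by metis
  have f_le: "norm (T (f n)) \<le> M" for n
    using order.trans[OF le[OF f(1)] mult_left_mono[OF f(2)]] \<open>M > 0\<close> by simp
  have lim_norm: "(\<lambda>n. norm (T (f n))) \<longlonglongrightarrow> M"
  proof (rule tendsto_sandwich[OF _ _ _ tendsto_const])
    show "(\<lambda>n. M - 1 / real (Suc n)) \<longlonglongrightarrow> M"
      using tendsto_diff[OF tendsto_const lim_inverse_n'[THEN LIMSEQ_Suc], of M] by simp
  qed (use f_le less_imp_le[OF f(3)] in \<open>auto intro!: always_eventually\<close>)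
  have "T (f n) \<in> closure (T ` cball 0 1)" for n
    using f(2) by (intro subsetD[OF closure_subset]) auto
  moreover have "seq_compact (closure (T ` cball 0 1))"
    using compact by (simp add: compact_operator_def compact_eq_seq_compact_metric)
  ultimately obtain y k where k: "strict_mono k" "((\<lambda>n. T (f n)) \<circ> k) \<longlonglongrightarrow> y"
    unfolding seq_compact_def by meson
  define g where "g = f \<circ> k"
  have Tg: "(\<lambda>n. T (g n)) \<longlonglongrightarrow> y" using k(2) by (simp add: g_def o_def)
  have norm_Tg: "(\<lambda>n. norm (T (g n))) \<longlonglongrightarrow> M"
    using LIMSEQ_subseq_LIMSEQ[OF lim_norm k(1)] by (simp add: g_def o_def)
  \<comment> \<open>Expanding the square gives the cross term
    \<open>- 2 * M\<^sup>2 * (norm (T (g n)))\<^sup>2\<close>; the two outer terms are bounded by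
    \<open>1\<close> and \<open>2\<close> below.\<close>
  have sq: "(norm (T (T (g n)) - M\<^sup>2 *\<^sub>R g n))\<^sup>2 \<le> M\<^sup>2 * (M\<^sup>2 - (norm (T (g n)))\<^sup>2)" for n
  proof -
    have g: "g n \<in> V" "norm (g n) \<le> 1" using f by (auto simp: g_def)
    have 1: "(norm (T (T (g n))))\<^sup>2 \<le> M\<^sup>2 * (norm (T (g n)))\<^sup>2"
      using power_mono[OF le[OF V_T[OF g(1)]], of 2] by (simp add: power_mult_distrib)
    have 2: "(norm (M\<^sup>2 *\<^sub>R g n))\<^sup>2 \<le> M\<^sup>2 * M\<^sup>2"
      using mult_left_mono[OF power_mono[OF g(2), of 2], of "M\<^sup>2 * M\<^sup>2"]
      using \<open>M > 0\<close> by (simp add: power_mult_distrib power2_eq_square mult_ac)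
    have 3: "inner (T (T (g n))) (M\<^sup>2 *\<^sub>R g n) = M\<^sup>2 * (norm (T (g n)))\<^sup>2"
      by (simp add: inner_symmetric power2_norm_eq_inner)
    have "c \<le> q - m" if "a \<le> m" "b \<le> q" "m = (a + b - c) / 2" for a b c m q :: real
      using that by (simp add: field_simps)
    from this[OF 1 2 trans[OF 3[symmetric] dot_norm_neg]] show ?thesis
      by (simp only: right_diff_distrib)
  qed
  have "(\<lambda>n. M\<^sup>2 * (M\<^sup>2 - (norm (T (g n)))\<^sup>2)) \<longlonglongrightarrow> M\<^sup>2 * (M\<^sup>2 - M\<^sup>2)"
    by (intro tendsto_intros norm_Tg)
  then have lim: "(\<lambda>n. M\<^sup>2 * (M\<^sup>2 - (norm (T (g n)))\<^sup>2)) \<longlonglongrightarrow> 0" by simp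
  have "(\<lambda>n. (norm (T (T (g n)) - M\<^sup>2 *\<^sub>R g n))\<^sup>2) \<longlonglongrightarrow> 0"
  proof (rule tendsto_sandwich[OF _ _ tendsto_const lim])
    show "\<forall>\<^sub>F n in sequentially. 0 \<le> (norm (T (T (g n)) - M\<^sup>2 *\<^sub>R g n))\<^sup>2"
      by (rule always_eventually) simp
    show "\<forall>\<^sub>F n in sequentially. (norm (T (T (g n)) - M\<^sup>2 *\<^sub>R g n))\<^sup>2
        \<le> M\<^sup>2 * (M\<^sup>2 - (norm (T (g n)))\<^sup>2)"
      by (rule always_eventually) (rule allI, rule sq)
  qed
  then have "(\<lambda>n. sqrt ((norm (T (T (g n)) - M\<^sup>2 *\<^sub>R g n))\<^sup>2)) \<longlonglongrightarrow> sqrt 0"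
    by (rule tendsto_real_sqrt)
  then have "(\<lambda>n. T (T (g n)) - M\<^sup>2 *\<^sub>R g n) \<longlonglongrightarrow> 0"
    by (simp add: tendsto_norm_zero_iff)
  \<comment> \<open>Only \<open>T (g n)\<close> converges by compactness. Since \<open>g n\<close>
    is asymptotically \<open>T (T (g n))\<close> divided by \<open>M\<^sup>2\<close>, it converges
    as well.\<close>
  from tendsto_diff[OF tendsto_T[OF Tg] this] have "(\<lambda>n. M\<^sup>2 *\<^sub>R g n) \<longlonglongrightarrow> T y" by simp
  from tendsto_scaleR[OF tendsto_const this, of "1 / M\<^sup>2"]
  have g: "g \<longlonglongrightarrow> (1 / M\<^sup>2) *\<^sub>R T y" using \<open>M > 0\<close> by simp
  define z where "z = (1 / M\<^sup>2) *\<^sub>R T y"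
  have "y = T z"
    using Tg tendsto_T[OF g] LIMSEQ_unique unfolding z_def by blast
  then have 1: "T (T z) = M\<^sup>2 *\<^sub>R z" using \<open>M > 0\<close> by (simp add: z_def)
  have "norm (T z) = M"
    using tendsto_norm[OF Tg] norm_Tg \<open>y = T z\<close> LIMSEQ_unique by blast
  then have 2: "z \<noteq> 0" using \<open>M > 0\<close> by (auto simp: T_simps)
  have 3: "cinner e z = 0" if "e \<in> A" for e
  proof -
    have "(\<lambda>n. cinner e (g n)) \<longlonglongrightarrow> cinner e z"
      using bounded_linear.tendsto[OF bounded_linear_cinner_right g] by (simp add: z_def)
    moreover have "(\<lambda>n. cinner e (g n)) = (\<lambda>n. 0)" using f(1) that by (simp add: g_def V_def)
    ultimately show ?thesis by (simp add: LIMSEQ_const_iff)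
  qed
  show ?thesis using 1 2 3 \<open>M > r\<close> by blast
qed

text \<open>\<open>T\<^sup>2 - M\<^sup>2\<close> factors as \<open>(T - M) (T + M)\<close>: either
  \<open>z\<close> is an eigenvector for \<open>- M\<close>, or \<open>T z + M z\<close> is a
  nonzero eigenvector for \<open>M\<close>.\<close>

lemma eigenvector_exists:
  assumes A: "eigenvectors r' A" and r: "r \<ge> 0"
    and x: "\<And>e. e \<in> A \<Longrightarrow> cinner e x = 0" "norm (T x) > r * norm x"
  shows "\<exists>v. norm v = 1 \<and> eigenvectors r {v} \<and> (\<forall>e\<in>A. cinner e v = 0)"
proof -
  obtain z M where z: "z \<noteq> 0" "M > r" "T (T z) = M\<^sup>2 *\<^sub>R z" "\<And>e. e \<in> A \<Longrightarrow> cinner e z = 0"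
    using square_eigenvector_exists[OF assms] by blast
  have "\<exists>w l. w \<noteq> 0 \<and> T w = complex_of_real l *\<^sub>C w \<and> \<bar>l\<bar> > r \<and> (\<forall>e\<in>A. cinner e w = 0)"
  proof (cases "T z + M *\<^sub>R z = 0")
    case True
    then have "T z = complex_of_real (- M) *\<^sub>C z"
      by (simp add: scaleR_scaleC[symmetric] eq_neg_iff_add_eq_0 del: of_real_minus)
    then show ?thesis using z r by (intro exI[of _ z] exI[of _ "- M"]) auto
  next
    case False
    have "T (T z + M *\<^sub>R z) = complex_of_real M *\<^sub>C (T z + M *\<^sub>R z)"
      by (simp add: T_simps T_scaleR z(3) scaleR_scaleC[symmetric] scaleR_add_right power2_eq_square)
    moreover have "cinner e (T z + M *\<^sub>R z) = 0" if "e \<in> A" for e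
      using cinner_eigenvectors_T[OF A z(4)] z(4) that by (simp add: cinner_simps scaleR_scaleC)
    ultimately show ?thesis using False z(2) r by (intro exI[of _ "T z + M *\<^sub>R z"] exI[of _ M]) auto
  qed
  then obtain w l where w: "w \<noteq> 0" "T w = complex_of_real l *\<^sub>C w" "\<bar>l\<bar> > r" "\<And>e. e \<in> A \<Longrightarrow> cinner e w = 0"
    by blast
  define v where "v = complex_of_real (1 / norm w) *\<^sub>C w"
  have "T v = complex_of_real l *\<^sub>C v" by (simp add: v_def T_simps w(2) scaleC_scaleC mult.commute)
  then show ?thesis using w
    by (intro exI[of _ v]) (auto simp: v_def norm_scaleC norm_divide eigenvectors_def cinner_simps)
qed

section \<open>Spectral cutoff and eigenspaces\<close>

text \<open>Images of distinct members of \<open>A\<close> are orthogonal of norm greater than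
  \<open>r\<close>, hence more than \<open>r\<close> apart. A finite cover of the compact image by
  balls of radius \<open>r / 2\<close> holds at most one of them per ball.\<close>

lemma card_eigenvectors_bounded:
  assumes "r > 0"
  shows "\<exists>N. \<forall>A. finite A \<and> orthonormal A \<and> eigenvectors r A \<longrightarrow> card A \<le> N"
proof -
  have "\<exists>k. finite k \<and> k \<subseteq> closure (T ` cball 0 1) \<and> closure (T ` cball 0 1) \<subseteq> (\<Union>x\<in>k. ball x (r / 2))"
    using seq_compact_imp_totally_bounded[of "closure (T ` cball 0 1)"] compact half_gt_zero[OF assms]
    by (simp only: compact_operator_def compact_eq_seq_compact_metric)
  then obtain k where k: "finite k" "closure (T ` cball 0 1) \<subseteq> (\<Union>x\<in>k. ball x (r / 2))" by blast
  have "card A \<le> card k" if A: "finite A" "orthonormal A" "eigenvectors r A" for A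
  proof -
    have "\<exists>c\<in>k. dist c (T e) < r / 2" if "e \<in> A" for e
    proof -
      have "T e \<in> closure (T ` cball 0 1)"
        using orthonormal_norm[OF A(2) that] by (intro subsetD[OF closure_subset]) auto
      from subsetD[OF k(2) this] show ?thesis by simp
    qed
    then obtain c where c: "\<And>e. e \<in> A \<Longrightarrow> c e \<in> k" "\<And>e. e \<in> A \<Longrightarrow> dist (c e) (T e) < r / 2"
      by metis
    have "inj_on c A"
    proof (rule inj_onI, rule ccontr)
      fix e f assume ef: "e \<in> A" "f \<in> A" "c e = c f" "e \<noteq> f"
      obtain l m where l: "T e = complex_of_real l *\<^sub>C e" "\<bar>l\<bar> > r"
        and m: "T f = complex_of_real m *\<^sub>C f" "\<bar>m\<bar> > r"
        using A(3) ef unfolding eigenvectors_def by meson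
      have "cinner e f = 0" using A(2) ef by (simp add: orthonormal_def)
      then have "cinner (T e) (- T f) = 0" by (simp add: l m cinner_simps)
      from norm_add_orthogonal[OF this]
      have "(norm (T e - T f))\<^sup>2 = l\<^sup>2 + m\<^sup>2"
        using orthonormal_norm[OF A(2)] ef by (simp add: l m norm_scaleC)
      moreover have "r\<^sup>2 < l\<^sup>2" using l(2) assms by (metis abs_le_square_iff abs_of_pos not_le)
      moreover have "norm (T e - T f) < r"
        using c(2)[OF ef(1)] c(2)[OF ef(2)] ef(3) dist_triangle_half_r[of "c e" "T e" r "T f"]
        by (simp add: dist_norm)
      then have "(norm (T e - T f))\<^sup>2 < r\<^sup>2" by (intro power_strict_mono) auto
      ultimately show False using zero_le_power2[of m] by linarith
    qed
    then show ?thesis using c(1) k(1) by (intro card_inj_on_le) auto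
  qed
  then show ?thesis by blast
qed

text \<open>Take \<open>A\<close> of maximal cardinality. A vector violating the bound would yield a
  further eigenvector orthogonal to \<open>A\<close>.\<close>

lemma spectral_cutoff:
  assumes "r > 0"
  shows "\<exists>A. finite A \<and> orthonormal A \<and> eigenvectors r A \<and>
    (\<forall>x. (\<forall>e\<in>A. cinner e x = 0) \<longrightarrow> norm (T x) \<le> r * norm x)"
proof -
  define P where "P A \<longleftrightarrow> finite A \<and> orthonormal A \<and> eigenvectors r A" for A
  obtain N where N: "\<And>A. P A \<Longrightarrow> card A \<le> N"
    using card_eigenvectors_bounded[OF assms] unfolding P_def by blast
  have "P {}" by (simp add: P_def orthonormal_def eigenvectors_def)
  then obtain A where A: "P A" "\<And>A'. P A' \<Longrightarrow> card A' \<le> card A"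
    using ex_has_greatest_nat[of P "{}" card "Suc N"] N by (auto simp: less_Suc_eq_le)
  have "norm (T x) \<le> r * norm x" if x: "\<forall>e\<in>A. cinner e x = 0" for x
  proof (rule ccontr)
    assume "\<not> norm (T x) \<le> r * norm x"
    then obtain v where v: "norm v = 1" "eigenvectors r {v}" "\<And>e. e \<in> A \<Longrightarrow> cinner e v = 0"
      using eigenvector_exists[of r A r x] A(1) assms x by (auto simp: P_def)
    have "P (insert v A)" "v \<notin> A"
      using orthonormal_insert[OF _ v(1,3)] A(1) v(2) by (auto simp: P_def eigenvectors_def)
    then show False using A(2)[of "insert v A"] A(1) by (simp add: P_def)
  qed
  then show ?thesis using A(1) by (auto simp: P_def)
qed

text \<open>For \<open>r' > r\<close> the eigenspace of \<open>T\<^sup>2\<close> for \<open>r'\<^sup>2\<close> meets \<open>A\<^sup>\<bottom>\<close> trivially, where \<open>\<parallel>T\<parallel> \<le> r\<close>.\<close>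

lemma square_eigenspace:
  assumes A: "finite A" "orthonormal A" "eigenvectors r A"
    and le: "\<And>x. (\<And>e. e \<in> A \<Longrightarrow> cinner e x = 0) \<Longrightarrow> norm (T x) \<le> r * norm x"
    and r: "0 < r" "r < r'"
  shows "{x. T (T x) = complex_of_real (r'\<^sup>2) *\<^sub>C x} =
    complex_vector.span {e \<in> A. T (T e) = complex_of_real (r'\<^sup>2) *\<^sub>C e}" (is "?E = complex_vector.span ?B")
proof
  have sub: "complex_vector.subspace ?E"
    by (auto simp: complex_vector.subspace_def T_simps scaleC_add_right scaleC_scaleC mult.commute)
  then show "complex_vector.span ?B \<subseteq> ?E" by (intro complex_vector.span_minimal) auto
  show "?E \<subseteq> complex_vector.span ?B"
  proof
    fix x assume x: "x \<in> ?E"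
    have zero: "cinner e x = 0" if e: "e \<in> A" "e \<notin> ?B" for e
    proof -
      obtain l where l: "T e = complex_of_real l *\<^sub>C e" using A(3) e(1) by (auto simp: eigenvectors_def)
      then have TTe: "T (T e) = complex_of_real (l\<^sup>2) *\<^sub>C e"
        by (simp add: T_simps scaleC_scaleC power2_eq_square)
      then have "l\<^sup>2 \<noteq> r'\<^sup>2" using e by (auto simp del: of_real_power)
      moreover have "complex_of_real (l\<^sup>2) * cinner e x = complex_of_real (r'\<^sup>2) * cinner e x"
      proof -
        have "complex_of_real (l\<^sup>2) * cinner e x = cinner (T (T e)) x" by (simp add: TTe cinner_simps)
        also have "\<dots> = cinner e (T (T x))" by (simp add: symmetric)
        also have "\<dots> = complex_of_real (r'\<^sup>2) * cinner e x" using x by (simp add: cinner_simps)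
        finally show ?thesis .
      qed
      ultimately show ?thesis by (metis mult_cancel_right of_real_eq_iff)
    qed
    have pB: "proj A x = proj ?B x"
      unfolding proj_def using A(1) zero by (intro sum.mono_neutral_right) auto
    then have "proj A x \<in> ?E"
      using proj_in_span[of ?B x] \<open>complex_vector.span ?B \<subseteq> ?E\<close> by auto
    \<comment> \<open>The remainder \<open>y\<close> stays in the eigenspace, so \<open>T\<close>
      scales its norm by \<open>r'\<close>; being orthogonal to \<open>A\<close>, it is scaled by at
      most \<open>r < r'\<close>.\<close>
    define y where "y = x - proj A x"
    have y: "y \<in> ?E" using complex_vector.subspace_diff[OF sub x \<open>proj A x \<in> ?E\<close>] by (simp add: y_def)
    have "norm (T y) \<le> r * norm y" using cinner_diff_proj[OF A(2,1)] by (intro le) (simp add: y_def)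
    moreover have "(norm (T y))\<^sup>2 = (r' * norm y)\<^sup>2"
    proof -
      have "complex_of_real ((norm (T y))\<^sup>2) = cinner y (T (T y))"
        by (simp only: cinner_self[symmetric] symmetric)
      also have "\<dots> = complex_of_real ((r' * norm y)\<^sup>2)"
        using y by (simp add: cinner_simps cinner_self power_mult_distrib)
      finally show ?thesis by (simp only: of_real_eq_iff)
    qed
    then have "norm (T y) = r' * norm y" using r by (simp add: power2_eq_iff_nonneg)
    ultimately have "y = 0" using r by (simp add: mult_le_cancel_right)
    then have "x = proj ?B x" using pB by (simp add: y_def)
    then show "x \<in> complex_vector.span ?B" using proj_in_span by metis
  qed
qed

text \<open>The eigenspace of the square confines \<open>x\<close> to the span of \<open>A\<close>.
  Members of \<open>A\<close> with another eigenvalue, including \<open>- l\<close>, are orthogonal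
  to \<open>x\<close> and drop out of its expansion.\<close>

lemma eigenspace_subset:
  assumes A: "finite A" "orthonormal A" "eigenvectors r A"
    and le: "\<And>x. (\<And>e. e \<in> A \<Longrightarrow> cinner e x = 0) \<Longrightarrow> norm (T x) \<le> r * norm x"
    and r: "0 < r" "r < \<bar>l\<bar>"
    and x: "T x = complex_of_real l *\<^sub>C x"
  shows "x \<in> complex_vector.span {e \<in> A. T e = complex_of_real l *\<^sub>C e}" (is "_ \<in> complex_vector.span ?B")
proof -
  have "T (T x) = complex_of_real (\<bar>l\<bar>\<^sup>2) *\<^sub>C x" by (simp add: x T_simps scaleC_scaleC power2_eq_square)
  then have "x \<in> complex_vector.span {e \<in> A. T (T e) = complex_of_real (\<bar>l\<bar>\<^sup>2) *\<^sub>C e}"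
    using square_eigenspace[OF A le r] by blast
  then have "x \<in> complex_vector.span A" by (rule subsetD[OF complex_vector.span_mono, rotated]) auto
  then have "x = proj A x" using proj_eq A by metis
  also have "\<dots> = proj ?B x"
    unfolding proj_def
  proof (rule sum.mono_neutral_right)
    show "\<forall>e\<in>A - ?B. cinner e x *\<^sub>C e = 0"
    proof
      fix e assume e: "e \<in> A - ?B"
      obtain m where m: "T e = complex_of_real m *\<^sub>C e" using A(3) e by (auto simp: eigenvectors_def)
      then have "m \<noteq> l" using e by auto
      moreover have "complex_of_real m * cinner e x = complex_of_real l * cinner e x"
        using symmetric[of e x] by (simp add: m x cinner_simps)
      ultimately have "cinner e x = 0" by (metis mult_cancel_right of_real_eq_iff)
      then show "cinner e x *\<^sub>C e = 0" by simp
    qed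
  qed (use A in auto)
  finally show ?thesis using proj_in_span by metis
qed

section \<open>Comparison with the singular values\<close>

text \<open>Sort \<open>A\<close> by the absolute value \<open>r'\<close> of the eigenvalue. Each
  class is a basis of the eigenspace of \<open>T\<^sup>2\<close> for \<open>r'\<^sup>2\<close>,
  whose dimension counts how often \<open>r'\<close> occurs in \<open>s\<close>.\<close>

lemma card_eigenvectors_le:
  assumes A: "finite A" "orthonormal A" "eigenvectors r A"
    and le: "\<And>x. (\<And>e. e \<in> A \<Longrightarrow> cinner e x = 0) \<Longrightarrow> norm (T x) \<le> r * norm x"
    and r: "0 < r" and s: "singular_values T s"
  shows "card A \<le> card {k. s k > r}"
proof -
  have adj: "cadjoint T = T"
    unfolding cadjoint_def
  proof (rule the_equality)
    fix S assume S: "\<forall>x y. cinner (T x) y = cinner x (S y)"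
    show "S = T"
    proof (rule ext, rule cinner_ext)
      show "cinner z (S x) = cinner z (T x)" for x z using S by (simp add: symmetric[symmetric])
    qed
  qed (simp add: symmetric)
  have s0: "s \<longlonglongrightarrow> 0" and cards: "\<And>r. r > 0 \<Longrightarrow> card {k. s k = r} =
      complex_vector.dim {x. T (T x) = complex_of_real (r\<^sup>2) *\<^sub>C x}"
    using s by (simp_all add: singular_values_def adj)
  \<comment> \<open>Without finiteness the comparison of cardinalities would fail, since
    \<open>card\<close> of an infinite set is 0.\<close>
  have fin: "finite {k. s k > r}"
  proof -
    have "\<forall>\<^sub>F k in sequentially. s k < r" using order_tendstoD(2)[OF s0] r by blast
    then obtain N where "\<And>k. k \<ge> N \<Longrightarrow> s k < r" by (auto simp: eventually_sequentially)
    then have "{k. s k > r} \<subseteq> {..<N}" by (force simp: not_le[symmetric])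
    then show ?thesis by (rule finite_subset) simp
  qed
  define E where "E r' = {e \<in> A. T (T e) = complex_of_real (r'\<^sup>2) *\<^sub>C e}" for r'
  have "\<forall>e\<in>A. \<exists>l. T e = complex_of_real l *\<^sub>C e \<and> \<bar>l\<bar> > r" using A(3) by (simp add: eigenvectors_def)
  then obtain l where l: "\<And>e. e \<in> A \<Longrightarrow> T e = complex_of_real (l e) *\<^sub>C e" "\<And>e. e \<in> A \<Longrightarrow> \<bar>l e\<bar> > r"
    by metis
  define R where "R = (\<lambda>e. \<bar>l e\<bar>) ` A"
  have "A = (\<Union>r'\<in>R. E r')"
    by (auto simp: R_def E_def l T_simps scaleC_scaleC power2_eq_square simp flip: of_real_mult)
  then have "card A \<le> (\<Sum>r'\<in>R. card (E r'))"
    using card_UN_le[of R E] A(1) by (simp add: R_def)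
  also have "\<dots> = (\<Sum>r'\<in>R. card {k. s k = r'})"
  proof (rule sum.cong)
    fix r' assume "r' \<in> R"
    then have r': "r' > r" using l by (auto simp: R_def)
    have "{x. T (T x) = complex_of_real (r'\<^sup>2) *\<^sub>C x} = complex_vector.span (E r')"
      unfolding E_def by (rule square_eigenspace[OF A le r r'])
    moreover have "complex_vector.independent (E r')"
      by (intro orthonormal_independent orthonormal_mono[OF A(2)]) (auto simp: E_def)
    ultimately have "complex_vector.dim {x. T (T x) = complex_of_real (r'\<^sup>2) *\<^sub>C x} = card (E r')"
      by (metis complex_vector.dim_span_eq_card_independent)
    then show "card (E r') = card {k. s k = r'}" using cards r r' by simp
  qed simp
  also have "\<dots> = card (\<Union>r'\<in>R. {k. s k = r'})"
  proof (rule card_UN_disjoint[symmetric])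
    show "\<forall>r'\<in>R. finite {k. s k = r'}"
      using l by (auto simp: R_def intro!: finite_subset[OF _ fin])
  qed (use A(1) in \<open>auto simp: R_def\<close>)
  also have "\<dots> \<le> card {k. s k > r}"
    using l fin by (intro card_mono) (auto simp: R_def)
  finally show ?thesis .
qed

section \<open>An orthonormal basis of eigenvectors\<close>

text \<open>Join orthonormal bases of the eigenspaces for all nonzero eigenvalues. By the cutoff,
  \<open>T x\<close> is a limit of combinations of such eigenvectors, and density of the range does
  the rest.\<close>

lemma eigenbasis_exists:
  assumes dense: "closure (range T) = UNIV"
  shows "\<exists>B. orthonormal_basis B \<and> (\<forall>e\<in>B. \<exists>l. T e = complex_of_real l *\<^sub>C e)"
proof -
  have "\<exists>A. \<forall>r>0. finite (A r) \<and> orthonormal (A r) \<and> eigenvectors r (A r) \<and>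
    (\<forall>x. (\<forall>e\<in>A r. cinner e x = 0) \<longrightarrow> norm (T x) \<le> r * norm x)"
    using spectral_cutoff by metis
  then obtain A where A0: "\<forall>r>0. finite (A r) \<and> orthonormal (A r) \<and> eigenvectors r (A r) \<and>
    (\<forall>x. (\<forall>e\<in>A r. cinner e x = 0) \<longrightarrow> norm (T x) \<le> r * norm x)" ..
  then have A: "r > 0 \<Longrightarrow> finite (A r)" "r > 0 \<Longrightarrow> orthonormal (A r)"
      "r > 0 \<Longrightarrow> eigenvectors r (A r)"
      "r > 0 \<Longrightarrow> (\<And>e. e \<in> A r \<Longrightarrow> cinner e x = 0) \<Longrightarrow> norm (T x) \<le> r * norm x" for r x
    by simp_all
  \<comment> \<open>A cutoff at half of \<open>\<bar>l\<bar>\<close> lies strictly below it, so for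
    \<open>l \<noteq> 0\<close> the set \<open>b l\<close> spans the whole eigenspace of
    \<open>l\<close>.\<close>
  define b where "b l = {e \<in> A (\<bar>l\<bar> / 2). T e = complex_of_real l *\<^sub>C e}" for l
  define B where "B = (\<Union>l\<in>-{0}. b l)"
  have eig: "x \<in> complex_vector.span B" if "l \<noteq> 0" "T x = complex_of_real l *\<^sub>C x" for l x
  proof -
    have p: "0 < \<bar>l\<bar> / 2" using that by simp
    have "x \<in> complex_vector.span (b l)"
      using eigenspace_subset[OF A(1-3)[OF p] A(4)[OF p] p _ that(2)] that(1) by (simp add: b_def)
    then show ?thesis
      by (rule subsetD[OF complex_vector.span_mono, rotated]) (use that in \<open>auto simp: B_def\<close>)
  qed
  have "orthonormal B"
    unfolding orthonormal_def
  proof (intro ballI)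
    fix e f assume "e \<in> B" "f \<in> B"
    then obtain l m where lm: "l \<noteq> 0" "e \<in> b l" "m \<noteq> 0" "f \<in> b m" by (auto simp: B_def)
    show "cinner e f = (if e = f then 1 else 0)"
    proof (cases "l = m")
      case True
      then show ?thesis using A(2)[of "\<bar>l\<bar> / 2"] lm by (auto simp: b_def orthonormal_def)
    next
      case False
      have "complex_of_real l * cinner e f = complex_of_real m * cinner e f"
        using symmetric[of e f] lm by (simp add: b_def cinner_simps)
      then have 0: "cinner e f = 0" using False by (metis mult_cancel_right of_real_eq_iff)
      have "norm e = 1" using orthonormal_norm[OF A(2)[of "\<bar>l\<bar> / 2"]] lm by (simp add: b_def)
      then show ?thesis using 0 by (auto simp: cinner_self)
    qed
  qed
  moreover have "range T \<subseteq> closure (complex_vector.span B)"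
  proof safe
    fix x
    show "T x \<in> closure (complex_vector.span B)"
      unfolding closure_approachable
    proof (intro allI impI)
      fix \<epsilon> :: real assume "\<epsilon> > 0"
      \<comment> \<open>The summand 1 keeps the quotient meaningful for \<open>x = 0\<close> and
        makes the final estimate strict.\<close>
      define r where "r = \<epsilon> / (norm x + 1)"
      have "r > 0" using \<open>\<epsilon> > 0\<close> by (simp add: r_def add_nonneg_pos)
      note A = A[OF \<open>r > 0\<close>]
      have "T (proj (A r) x) = (\<Sum>e\<in>A r. cinner e x *\<^sub>C T e)"
        unfolding proj_def by (simp add: bounded_clinear_sum[OF bounded_clinear] T_simps)
      also have "\<dots> \<in> complex_vector.span B"
      proof (intro complex_vector.span_sum complex_vector.span_scale)
        fix e assume "e \<in> A r"
        then obtain l where l: "T e = complex_of_real l *\<^sub>C e" "\<bar>l\<bar> > r" using A(3) by (auto simp: eigenvectors_def)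
        have "e \<in> complex_vector.span B" using eig[OF _ l(1)] l(2) \<open>r > 0\<close> by auto
        then show "T e \<in> complex_vector.span B" using l(1) complex_vector.span_scale by simp
      qed
      finally have "T (proj (A r) x) \<in> complex_vector.span B" .
      moreover have "dist (T (proj (A r) x)) (T x) < \<epsilon>"
      proof -
        have "norm (T x - T (proj (A r) x)) \<le> r * norm (x - proj (A r) x)"
          unfolding T_simps[symmetric] using cinner_diff_proj[OF A(2,1)] by (intro A(4))
        also have "\<dots> \<le> r * norm x"
          using norm_diff_proj_le'[OF A(2,1)] \<open>r > 0\<close> by (intro mult_left_mono) auto
        also have "\<dots> < r * (norm x + 1)" using \<open>r > 0\<close> by (intro mult_strict_left_mono) auto
        also have "\<dots> = \<epsilon>" by (simp add: r_def add_nonneg_eq_0_iff)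
        finally show ?thesis by (simp add: dist_norm norm_minus_commute)
      qed
      ultimately show "\<exists>y\<in>complex_vector.span B. dist y (T x) < \<epsilon>" by blast
    qed
  qed
  then have "closure (complex_vector.span B) = UNIV"
    using closure_minimal[of "range T" "closure (complex_vector.span B)"] dense by auto
  moreover have "\<forall>e\<in>B. \<exists>l. T e = complex_of_real l *\<^sub>C e" by (auto simp: B_def b_def)
  ultimately show ?thesis using orthonormal_basis_iff by blast
qed

end

\<comment> \<open>Completeness in the form in which absolutely summable families are known to be
  summable.\<close>
subclass (in complex_hilbert) banach ..

section \<open>Approximation by operators of finite rank\<close>

text \<open>A spanning set bounds the rank safely, whereas \<open>dim\<close> is 0 on
  infinite-dimensional spaces.\<close>

definition rank_le :: "nat \<Rightarrow> ('h::complex_hilbert \<Rightarrow> 'h) \<Rightarrow> bool" where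
  "rank_le k F \<longleftrightarrow> bounded_clinear F \<and>
     (\<exists>A. finite A \<and> card A \<le> k \<and> range F \<subseteq> complex_vector.span A)"

lemma rank_leD: "rank_le k F \<Longrightarrow> bounded_clinear F"
  by (simp add: rank_le_def)

lemma rank_le_0: "rank_le 0 (\<lambda>x. 0)"
  by (auto simp: rank_le_def bounded_clinear_0 intro!: exI[of _ "{}"])

lemma rank_le_mono: "rank_le k F \<Longrightarrow> k \<le> l \<Longrightarrow> rank_le l F"
  unfolding rank_le_def by (meson le_trans)

lemma rank_le_add:
  assumes "rank_le k F" "rank_le l G"
  shows "rank_le (k + l) (\<lambda>x. F x + G x)"
proof -
  obtain A B where A: "finite A" "card A \<le> k" "range F \<subseteq> complex_vector.span A"
    and B: "finite B" "card B \<le> l" "range G \<subseteq> complex_vector.span B"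
    using assms unfolding rank_le_def by blast
  have "F x + G x \<in> complex_vector.span (A \<union> B)" for x
    using A(3) B(3) complex_vector.span_mono[of A "A \<union> B"] complex_vector.span_mono[of B "A \<union> B"]
    by (intro complex_vector.span_add) auto
  moreover have "card (A \<union> B) \<le> k + l" using card_Un_le[of A B] A(2) B(2) by linarith
  ultimately show ?thesis
    unfolding rank_le_def
    using A(1) B(1) bounded_clinear_plus[OF rank_leD[OF assms(1)] rank_leD[OF assms(2)]]
    by (intro conjI exI[of _ "A \<union> B"]) auto
qed

lemma rank_le_compose_left:
  assumes "rank_le k F" "bounded_clinear S"
  shows "rank_le k (S \<circ> F)"
proof -
  obtain A where A: "finite A" "card A \<le> k" "range F \<subseteq> complex_vector.span A"
    using assms(1) unfolding rank_le_def by blast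
  have S: "S y \<in> complex_vector.span (S ` A)" if "y \<in> complex_vector.span A" for y
    using that
  proof (induction rule: complex_vector.span_induct_alt)
    case base
    then show ?case by (simp add: bounded_clinear_zero[OF assms(2)] complex_vector.span_zero)
  next
    case (step c x y)
    then have "S x \<in> complex_vector.span (S ` A)" by (intro complex_vector.span_base) auto
    then show ?case
      unfolding bounded_clinear_add[OF assms(2)] bounded_clinear_scaleC[OF assms(2)]
      by (intro complex_vector.span_add complex_vector.span_scale step.IH)
  qed
  have "card (S ` A) \<le> k" using card_image_le[OF A(1), of S] A(2) by linarith
  then show ?thesis
    unfolding rank_le_def using A S bounded_clinear_compose[OF assms(2) rank_leD[OF assms(1)]]
    by (intro conjI exI[of _ "S ` A"]) auto
qed

lemma rank_le_compose_right:
  assumes "rank_le k F" "bounded_clinear S"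
  shows "rank_le k (F \<circ> S)"
  using assms bounded_clinear_compose unfolding rank_le_def by fastforce

lemma rank_le_minus:
  assumes "rank_le k F" "rank_le l G"
  shows "rank_le (k + l) (\<lambda>x. F x - G x)"
proof -
  have "bounded_clinear (\<lambda>x. - x :: 'a)" by (rule bounded_clinearI[where K = 1]) simp_all
  from rank_le_add[OF assms(1) rank_le_compose_left[OF assms(2) this]] show ?thesis by simp
qed

lemma rank_le_orthonormal:
  assumes "rank_le k F"
  obtains A where "finite A" "orthonormal A" "card A \<le> k" "\<And>x. F x = (\<Sum>e\<in>A. cinner e (F x) *\<^sub>C e)"
proof -
  obtain B where B: "finite B" "card B \<le> k" "range F \<subseteq> complex_vector.span B"
    using assms unfolding rank_le_def by blast
  obtain A where A: "orthonormal A" "finite A" "card A \<le> card B" "B \<subseteq> complex_vector.span A"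
    using orthonormal_spanning_exists[OF B(1)] by blast
  have "F x \<in> complex_vector.span A" for x
    using B(3) complex_vector.span_minimal[OF A(4) complex_vector.subspace_span] by blast
  then have "F x = (\<Sum>e\<in>A. cinner e (F x) *\<^sub>C e)" for x
    using proj_eq[OF A(1,2)] by (simp add: proj_def)
  then show ?thesis using that A B(2) by force
qed

text \<open>Says that the approximation numbers of \<open>S\<close>, hence its singular values, are \<open>O(k\<^sup>-\<^sup>q)\<close>.\<close>

definition weak_order :: "real \<Rightarrow> ('h::complex_hilbert \<Rightarrow> 'h) \<Rightarrow> bool" where
  "weak_order q S \<longleftrightarrow> bounded_clinear S \<and>
     (\<exists>C d. C \<ge> 0 \<and> (\<forall>m. \<exists>F. rank_le (d * m) F \<and>
        (\<forall>x. norm (S x - F x) \<le> C * (real m + 1) powr (- q) * norm x)))"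

lemma weak_orderD: "weak_order q S \<Longrightarrow> bounded_clinear S"
  by (simp add: weak_order_def)

text \<open>Approximation by 0 suffices. Bounded factors can thus be inserted into a product without
  lowering its order.\<close>

lemma weak_order_0:
  assumes "bounded_clinear S"
  shows "weak_order 0 S"
proof -
  obtain K where K: "K > 0" "\<And>x. norm (S x) \<le> K * norm x"
    using bounded_clinear_bound[OF assms] by blast
  show ?thesis
    unfolding weak_order_def
    using assms K rank_le_0 by (intro conjI exI[of _ K] exI[of _ 0] allI exI[of _ "\<lambda>x. 0"]) auto
qed

text \<open>With \<open>H = F (T - G) + S G\<close> the error factors as
  \<open>S T - H = (S - F) (T - G)\<close>: errors multiply while ranks add.\<close>

lemma weak_order_compose:
  assumes "weak_order p S" "weak_order q T"
  shows "weak_order (p + q) (S \<circ> T)"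
proof -
  obtain C d where C: "C \<ge> 0" and S: "\<And>m. \<exists>F. rank_le (d * m) F \<and>
      (\<forall>x. norm (S x - F x) \<le> C * (real m + 1) powr (- p) * norm x)"
    using assms(1) unfolding weak_order_def by blast
  obtain C' d' where C': "C' \<ge> 0" and T: "\<And>m. \<exists>F. rank_le (d' * m) F \<and>
      (\<forall>x. norm (T x - F x) \<le> C' * (real m + 1) powr (- q) * norm x)"
    using assms(2) unfolding weak_order_def by blast
  note bS = weak_orderD[OF assms(1)] and bT = weak_orderD[OF assms(2)]
  have "\<exists>H. rank_le ((d + d') * m) H \<and>
      (\<forall>x. norm ((S \<circ> T) x - H x) \<le> (C * C') * (real m + 1) powr (- (p + q)) * norm x)" for m
  proof -
    obtain F where F: "rank_le (d * m) F"
        "\<And>x. norm (S x - F x) \<le> C * (real m + 1) powr (- p) * norm x" using S by blast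
    obtain G where G: "rank_le (d' * m) G"
        "\<And>x. norm (T x - G x) \<le> C' * (real m + 1) powr (- q) * norm x" using T by blast
    note bF = rank_leD[OF F(1)] and bG = rank_leD[OF G(1)]
    define H where "H = (\<lambda>x. (F \<circ> (\<lambda>x. T x - G x)) x + (S \<circ> G) x)"
    have "rank_le (d * m + d' * m) H"
      unfolding H_def
      by (intro rank_le_add rank_le_compose_right rank_le_compose_left F G bS bounded_clinear_minus_op bT bG)
    moreover have "norm ((S \<circ> T) x - H x) \<le> (C * C') * (real m + 1) powr (- (p + q)) * norm x" for x
    proof -
      have "(S \<circ> T) x - H x = S (T x - G x) - F (T x - G x)"
        by (simp add: H_def bounded_clinear_diff[OF bS] bounded_clinear_diff[OF bF])
      also have "norm \<dots> \<le> C * (real m + 1) powr (- p) * norm (T x - G x)" by (rule F(2))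
      also have "\<dots> \<le> C * (real m + 1) powr (- p) * (C' * (real m + 1) powr (- q) * norm x)"
        using C by (intro mult_left_mono G(2)) auto
      also have "\<dots> = (C * C') * (real m + 1) powr (- (p + q)) * norm x"
        using powr_add[of "real m + 1" "- p" "- q"] by simp
      finally show ?thesis .
    qed
    ultimately show ?thesis by (auto simp: algebra_simps)
  qed
  then show ?thesis
    unfolding weak_order_def using bounded_clinear_compose[OF bS bT] C C'
    by (intro conjI exI[of _ "C * C'"] exI[of _ "d + d'"]) auto
qed

section \<open>Nuclear expansions and the trace\<close>

text \<open>An absolutely convergent sum of operators of rank one, where \<open>c i\<close> bounds
  the norm of \<open>\<phi> i\<close>. With functionals in place of vectors, composing with an
  operator on the right requires no adjoint.\<close>

definition nuclear_expansion ::
  "'i set \<Rightarrow> ('i \<Rightarrow> 'h::complex_hilbert \<Rightarrow> complex) \<Rightarrow> ('i \<Rightarrow> 'h) \<Rightarrow> ('h \<Rightarrow> 'h) \<Rightarrow> bool" where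
  "nuclear_expansion I \<phi> u S \<longleftrightarrow>
     (\<exists>c. (\<forall>i\<in>I. clinear (\<phi> i) \<and> 0 \<le> c i \<and> (\<forall>x. cmod (\<phi> i x) \<le> c i * norm x)) \<and>
        (\<lambda>i. c i * norm (u i)) summable_on I) \<and>
     (\<forall>x. ((\<lambda>i. \<phi> i x *\<^sub>C u i) has_sum S x) I)"

lemma norm_orthonormal_sum:
  assumes "orthonormal A" "finite A"
  shows "(norm (\<Sum>e\<in>A. a e *\<^sub>C e))\<^sup>2 = (\<Sum>e\<in>A. (cmod (a e))\<^sup>2)"
proof -
  have "cinner e (\<Sum>f\<in>A. a f *\<^sub>C f) = a e" if "e \<in> A" for e
  proof -
    have "cinner e (\<Sum>f\<in>A. a f *\<^sub>C f) = (\<Sum>f\<in>A. if f = e then a f else 0)"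
      unfolding cinner_sum_right
      using assms(1) that by (intro sum.cong) (auto simp: cinner_simps orthonormal_def)
    then show ?thesis using assms(2) that by simp
  qed
  then have "cinner (\<Sum>e\<in>A. a e *\<^sub>C e) (\<Sum>e\<in>A. a e *\<^sub>C e) = (\<Sum>e\<in>A. cnj (a e) * a e)"
    unfolding cinner_sum_left by (intro sum.cong) (auto simp: cinner_scaleC_left)
  also have "\<dots> = complex_of_real (\<Sum>e\<in>A. (cmod (a e))\<^sup>2)"
    by (simp add: complex_norm_square[symmetric] mult.commute)
  finally have "complex_of_real ((norm (\<Sum>e\<in>A. a e *\<^sub>C e))\<^sup>2) = complex_of_real (\<Sum>e\<in>A. (cmod (a e))\<^sup>2)"
    by (simp only: cinner_self[symmetric])
  then show ?thesis by (simp only: of_real_eq_iff)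
qed

lemma clinear_sum:
  fixes \<phi> :: "'h::complex_hilbert \<Rightarrow> complex"
  assumes "clinear \<phi>"
  shows "\<phi> (\<Sum>e\<in>A. a e *\<^sub>C f e) = (\<Sum>e\<in>A. a e * \<phi> (f e))"
proof -
  have "\<phi> 0 = 0" using assms unfolding clinear_iff by (metis add_cancel_left_left add_0)
  then show ?thesis
    using assms unfolding clinear_iff
    by (induction A rule: infinite_finite_induct) simp_all
qed

text \<open>Multiplying the coefficients of \<open>u\<close> by unimodular numbers aligns the phases of the summands
  without changing the norm of the partial expansion of \<open>u\<close>.\<close>

lemma sum_functional_le:
  fixes \<phi> :: "'h::complex_hilbert \<Rightarrow> complex"
  assumes F: "orthonormal F" "finite F"
    and \<phi>: "clinear \<phi>" "\<And>x. cmod (\<phi> x) \<le> c * norm x" "c \<ge> 0"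
  shows "(\<Sum>e\<in>F. cmod (\<phi> e * cinner e u)) \<le> c * norm u"
proof -
  have "\<forall>e. \<exists>w. cmod w = 1 \<and> w * (\<phi> e * cinner e u) = complex_of_real (cmod (\<phi> e * cinner e u))"
    by (metis cmod_unimodular)
  then obtain w where w: "\<And>e. cmod (w e) = 1"
      "\<And>e. w e * (\<phi> e * cinner e u) = complex_of_real (cmod (\<phi> e * cinner e u))" by metis
  define v where "v = (\<Sum>e\<in>F. (w e * cinner e u) *\<^sub>C e)"
  have "\<phi> v = complex_of_real (\<Sum>e\<in>F. cmod (\<phi> e * cinner e u))"
    unfolding v_def clinear_sum[OF \<phi>(1)] of_real_sum
    by (intro sum.cong refl) (simp only: w(2)[symmetric] mult_ac)
  moreover have "0 \<le> (\<Sum>e\<in>F. cmod (\<phi> e * cinner e u))" by (simp add: sum_nonneg)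
  ultimately have "(\<Sum>e\<in>F. cmod (\<phi> e * cinner e u)) = cmod (\<phi> v)" by (simp del: of_real_sum)
  also have "\<dots> \<le> c * norm v" by (rule \<phi>)
  also have "norm v = norm (proj F u)"
  proof -
    have "(norm v)\<^sup>2 = (norm (proj F u))\<^sup>2"
      unfolding v_def proj_def norm_orthonormal_sum[OF F] by (simp add: norm_mult w(1))
    then show ?thesis by simp
  qed
  also have "c * norm (proj F u) \<le> c * norm u"
    using norm_proj_le[OF F] \<phi>(3) by (rule mult_left_mono)
  finally show ?thesis .
qed

text \<open>Apply the continuous functional to the basis expansion of \<open>u\<close>.\<close>

lemma functional_basis_has_sum:
  fixes \<phi> :: "'h::complex_hilbert \<Rightarrow> complex"
  assumes "orthonormal_basis B" and \<phi>: "clinear \<phi>" "\<And>x. cmod (\<phi> x) \<le> c * norm x"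
  shows "((\<lambda>e. \<phi> e * cinner e u) has_sum \<phi> u) B"
proof -
  have "bounded_linear \<phi>"
    using \<phi> unfolding clinear_iff
    by (intro bounded_linear_intro[where K = c])
      (auto simp: scaleR_scaleC[where 'a = 'h] scaleR_conv_of_real mult.commute[of _ c])
  from has_sum_bounded_linear[OF this orthonormal_basis_expansion[OF assms(1), of u]]
  show ?thesis using \<phi>(1) unfolding clinear_iff by (simp add: mult.commute)
qed

text \<open>In the double family \<open>\<phi> i e * cinner e (u i)\<close>, summing over
  \<open>e\<close> first gives \<open>\<phi> i (u i)\<close>, independently of the basis, and
  summing over \<open>i\<close> first gives the diagonal entries. The bounds
  \<open>c i * norm (u i)\<close> justify the exchange.\<close>

lemma nuclear_expansion_has_sum:
  fixes \<phi> :: "'i \<Rightarrow> 'h::complex_hilbert \<Rightarrow> complex"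
  assumes B: "orthonormal_basis B" and S: "nuclear_expansion I \<phi> u S"
  shows "((\<lambda>e. cinner e (S e)) has_sum (\<Sum>\<^sub>\<infinity>i\<in>I. \<phi> i (u i))) B"
proof -
  obtain c where \<phi>: "\<And>i. i \<in> I \<Longrightarrow> clinear (\<phi> i)" "\<And>i. i \<in> I \<Longrightarrow> 0 \<le> c i"
      "\<And>i x. i \<in> I \<Longrightarrow> cmod (\<phi> i x) \<le> c i * norm x"
    and c: "(\<lambda>i. c i * norm (u i)) summable_on I"
    and S: "\<And>x. ((\<lambda>i. \<phi> i x *\<^sub>C u i) has_sum S x) I"
    using S unfolding nuclear_expansion_def by blast
  have onB: "orthonormal B" using B by (simp add: orthonormal_basis_iff)
  define h where "h = (\<lambda>(i, e). \<phi> i e * cinner e (u i))"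
  have partial: "(\<Sum>e\<in>F. cmod (h (i, e))) \<le> c i * norm (u i)" if "i \<in> I" "finite F" "F \<subseteq> B" for i F
    unfolding h_def using sum_functional_le[OF orthonormal_mono[OF onB that(3)] that(2) \<phi>(1,3,2)] that(1)
    by simp
  have inner: "(\<lambda>e. cmod (h (i, e))) summable_on B" if "i \<in> I" for i
    using partial[OF that] by (intro nonneg_bounded_partial_sums_imp_summable_on eventually_finite_subsets_at_top_weakI) auto
  have "(\<lambda>i. \<Sum>\<^sub>\<infinity>e\<in>B. cmod (h (i, e))) summable_on I"
  proof (rule summable_on_comparison_test[OF c])
    show "(\<Sum>\<^sub>\<infinity>e\<in>B. cmod (h (i, e))) \<le> c i * norm (u i)" if "i \<in> I" for i
      using partial[OF that] inner[OF that] by (intro infsum_le_finite_sums)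
  qed (simp add: infsum_nonneg)
  then have "(\<lambda>p. cmod (h p)) summable_on I \<times> B"
    using inner by (intro summable_on_SigmaI[where g = "\<lambda>i. \<Sum>\<^sub>\<infinity>e\<in>B. cmod (h (i, e))"]) auto
  then have h: "h summable_on I \<times> B" by (rule abs_summable_summable)
  have "(\<lambda>i. norm (\<phi> i (u i))) summable_on I"
    using \<phi> by (intro summable_on_comparison_test[OF c]) auto
  from has_sum_infsum[OF abs_summable_summable[OF this]]
  have "((\<lambda>i. \<phi> i (u i)) has_sum (\<Sum>\<^sub>\<infinity>i\<in>I. \<phi> i (u i))) I" .
  then have "(h has_sum (\<Sum>\<^sub>\<infinity>i\<in>I. \<phi> i (u i))) (I \<times> B)"
    using functional_basis_has_sum[OF B \<phi>(1,3)] h by (intro has_sum_SigmaI) (auto simp: h_def)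
  then have "((\<lambda>(e, i). h (i, e)) has_sum (\<Sum>\<^sub>\<infinity>i\<in>I. \<phi> i (u i))) (B \<times> I)"
    using has_sum_swap[where f = h and A = I and B = B] by simp
  then show ?thesis
  proof (rule has_sum_SigmaD)
    show "((\<lambda>i. (\<lambda>(e, i). h (i, e)) (e, i)) has_sum cinner e (S e)) I" for e
      using has_sum_bounded_linear[OF bounded_linear_cinner_right S, of e e]
      by (simp add: h_def cinner_scaleC_right)
  qed
qed

text \<open>The dyadic differences \<open>G m\<close> have rank of order \<open>2 ^ m\<close> and
  norm of order \<open>2 powr (- q * m)\<close>. Expanding each in an orthonormal set spanning its
  range costs rank times norm, which is summable over \<open>m\<close>.\<close>

lemma weak_order_nuclear_expansion:
  fixes S :: "'h::complex_hilbert \<Rightarrow> 'h"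
  assumes "weak_order q S" "q > 1"
  shows "\<exists>(I :: (nat \<times> 'h) set) \<phi> u. nuclear_expansion I \<phi> u S"
proof -
  obtain C d where C: "C \<ge> 0" and S: "\<And>m. \<exists>F. rank_le (d * m) F \<and>
      (\<forall>x. norm (S x - F x) \<le> C * (real m + 1) powr (- q) * norm x)"
    using assms(1) unfolding weak_order_def by blast
  \<comment> \<open>The error bound shrinks by \<open>\<rho>\<close> each time the rank bound
    doubles; \<open>2 * \<rho> < 1\<close> is where \<open>q > 1\<close> enters.\<close>
  define \<rho> where "\<rho> = (2::real) powr (- q)"
  have \<rho>: "\<rho> > 0" "\<rho> \<le> 1" "2 * \<rho> < 1"
  proof -
    show "\<rho> > 0" by (simp add: \<rho>_def)
    have "\<rho> < 2 powr (- 1)" using assms(2) unfolding \<rho>_def by (intro powr_less_mono) auto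
    then show "2 * \<rho> < 1" "\<rho> \<le> 1" by (simp_all add: powr_minus)
  qed
  have "\<exists>F. rank_le (d * 2 ^ m) F \<and> (\<forall>x. norm (S x - F x) \<le> C * \<rho> ^ m * norm x)" for m
  proof -
    obtain F where F: "rank_le (d * 2 ^ m) F"
        "\<And>x. norm (S x - F x) \<le> C * (real (2 ^ m) + 1) powr (- q) * norm x" using S by blast
    have "(real (2 ^ m) + 1) powr (- q) \<le> (2 ^ m) powr (- q)"
      using assms(2) by (intro powr_mono2') auto
    also have "\<dots> = \<rho> ^ m"
      unfolding \<rho>_def by (simp add: powr_realpow[symmetric] powr_powr mult.commute)
    finally have "C * (real (2 ^ m) + 1) powr (- q) * norm x \<le> C * \<rho> ^ m * norm x" for x
      using C by (intro mult_right_mono mult_left_mono) auto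
    then show ?thesis using F order.trans by blast
  qed
  then obtain F where F: "\<And>m. rank_le (d * 2 ^ m) (F m)" "\<And>m x. norm (S x - F m x) \<le> C * \<rho> ^ m * norm x"
    by metis
  obtain K where K: "K > 0" "\<And>x. norm (F 0 x) \<le> K * norm x"
    using bounded_clinear_bound[OF rank_leD[OF F(1)]] by blast
  \<comment> \<open>The differences telescope: the partial sum of \<open>G\<close> up to
    \<open>m\<close> is \<open>F m\<close>, which tends to \<open>S\<close>.\<close>
  define G where "G m = (case m of 0 \<Rightarrow> F 0 | Suc k \<Rightarrow> (\<lambda>x. F (Suc k) x - F k x))" for m
  have rank_G: "rank_le (d * 2 * 2 ^ m) (G m)" for m
  proof (cases m)
    case 0
    then show ?thesis using rank_le_mono[OF F(1)[of 0]] by (simp add: G_def)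
  next
    case (Suc k)
    then show ?thesis using rank_le_mono[OF rank_le_minus[OF F(1)[of m] F(1)[of k]]] by (simp add: G_def)
  qed
  \<comment> \<open>\<open>K\<close> covers \<open>G 0\<close>. For \<open>m = Suc k\<close> the two
    errors add up to at most \<open>2 * C * \<rho> ^ k\<close>, and dividing by
    \<open>\<rho>\<close> shifts the exponent to \<open>m\<close>.\<close>
  define L where "L = K + 2 * C / \<rho>"
  have "L \<ge> 0" using K(1) C \<rho> by (simp add: L_def)
  have norm_G: "norm (G m x) \<le> L * \<rho> ^ m * norm x" for m x
  proof (cases m)
    case 0
    have "K * norm x \<le> L * norm x" using C \<rho> by (intro mult_right_mono) (simp_all add: L_def)
    then show ?thesis using K(2)[of x] 0 by (simp add: G_def)
  next
    case (Suc k)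
    have "norm (G m x) = norm ((S x - F k x) - (S x - F m x))" by (simp add: G_def Suc)
    also have "\<dots> \<le> C * \<rho> ^ k * norm x + C * \<rho> ^ m * norm x"
      using norm_triangle_ineq4[of "S x - F k x" "S x - F m x"] F(2)[of x k] F(2)[of x m] by linarith
    also have "C * \<rho> ^ m * norm x \<le> C * \<rho> ^ k * norm x"
      using \<rho> C Suc by (intro mult_right_mono mult_left_mono power_decreasing) auto
    also have "C * \<rho> ^ k * norm x + C * \<rho> ^ k * norm x = 2 * C / \<rho> * \<rho> ^ m * norm x"
      using \<rho> by (simp add: Suc)
    also have "\<dots> \<le> L * \<rho> ^ m * norm x"
      using K(1) \<rho> by (intro mult_right_mono) (simp_all add: L_def)
    finally show ?thesis by simp
  qed
  have "\<exists>A. finite A \<and> orthonormal A \<and> card A \<le> d * 2 * 2 ^ m \<and> (\<forall>x. G m x = (\<Sum>e\<in>A. cinner e (G m x) *\<^sub>C e))" for m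
    by (rule rank_le_orthonormal[OF rank_G[of m]]) blast
  then obtain A where A: "\<And>m. finite (A m)" "\<And>m. orthonormal (A m)" "\<And>m. card (A m) \<le> d * 2 * 2 ^ m"
      "\<And>m x. G m x = (\<Sum>e\<in>A m. cinner e (G m x) *\<^sub>C e)" by metis
  \<comment> \<open>Pairs keep equal vectors from different sets \<open>A m\<close> apart.\<close>
  define I where "I = Sigma UNIV A"
  define \<phi> where "\<phi> = (\<lambda>(m, e) x. cinner e (G m x))"
  define c where "c = (\<lambda>(m, e::'h). L * \<rho> ^ m)"
  have geom: "summable (\<lambda>m. K * (2 * \<rho>) ^ m)" for K
    using \<rho> by (intro summable_mult summable_geometric) auto
  have card_le: "real (card (A m)) * (L * \<rho> ^ m) \<le> (2 * d * L) * (2 * \<rho>) ^ m" for m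
  proof -
    have "real (card (A m)) \<le> d * 2 * 2 ^ m" using A(3)[of m] of_nat_le_iff[of "card (A m)" "d * 2 * 2 ^ m", where 'a = real] by simp
    from mult_right_mono[OF this, of "L * \<rho> ^ m"] show ?thesis
      using \<open>L \<ge> 0\<close> \<rho> by (simp add: power_mult_distrib mult_ac)
  qed
  have card_summable: "(\<lambda>m. real (card (A m)) * (L * \<rho> ^ m)) summable_on UNIV"
  proof -
    have "summable (\<lambda>m. real (card (A m)) * (L * \<rho> ^ m))"
    proof (rule summable_comparison_test'[OF geom])
      show "norm (real (card (A m)) * (L * \<rho> ^ m)) \<le> (2 * d * L) * (2 * \<rho>) ^ m" for m
        using card_le[of m] \<open>L \<ge> 0\<close> \<rho> by simp
    qed
    then show ?thesis using \<open>L \<ge> 0\<close> \<rho> by (intro summable_nonneg_imp_summable_on) auto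
  qed
  have cI: "c summable_on I"
    unfolding I_def
  proof (rule summable_on_SigmaI[OF _ card_summable])
    show "((\<lambda>e. c (m, e)) has_sum real (card (A m)) * (L * \<rho> ^ m)) (A m)" for m
      using A(1) by (intro has_sum_finiteI) (simp_all add: c_def)
  qed (use \<open>L \<ge> 0\<close> \<rho> in \<open>simp add: c_def\<close>)
  have bound: "cmod (\<phi> i x) \<le> c i * norm x" if iI: "i \<in> I" for i x
  proof -
    obtain m e where i: "i = (m, e)" "e \<in> A m" using iI by (auto simp: I_def)
    have "cmod (cinner e (G m x)) \<le> 1 * norm (G m x)"
      using norm_cinner_le[of e "G m x"] orthonormal_norm[OF A(2) i(2)] by simp
    also have "\<dots> \<le> L * \<rho> ^ m * norm x" using norm_G by simp
    finally show ?thesis by (simp add: i \<phi>_def c_def)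
  qed
  have snd_I: "norm (snd i) = 1" if "i \<in> I" for i
    using that orthonormal_norm[OF A(2)] by (auto simp: I_def)
  have lin: "clinear (\<phi> i)" for i
    unfolding clinear_iff \<phi>_def using rank_leD[OF rank_G]
    by (auto simp: bounded_clinear_simps cinner_simps split: prod.splits)
  have S_sum: "((\<lambda>i. \<phi> i x *\<^sub>C snd i) has_sum S x) I" for x
    unfolding I_def
  proof (rule has_sum_SigmaI)
    show "((\<lambda>e. \<phi> (m, e) x *\<^sub>C snd (m, e)) has_sum G m x) (A m)" for m
      using A(1) A(4)[of m x] by (intro has_sum_finiteI) (simp_all add: \<phi>_def)
    show "((\<lambda>m. G m x) has_sum S x) UNIV"
    proof (rule norm_summable_imp_has_sum)
      have geometric: "summable (\<lambda>m. L * norm x * \<rho> ^ m)"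
        using \<rho> by (intro summable_mult summable_geometric) auto
      show "summable (\<lambda>m. norm (G m x))"
      proof (rule summable_comparison_test'[OF geometric])
        show "norm (norm (G m x)) \<le> L * norm x * \<rho> ^ m" for m
          using norm_G[of m x] by (simp add: mult_ac)
      qed
      have "(\<Sum>k\<le>m. G k x) = F m x" for m
        by (induction m) (simp_all add: G_def)
      moreover have "(\<lambda>m. F m x) \<longlonglongrightarrow> S x"
      proof -
        have "(\<lambda>m. C * norm x * \<rho> ^ m) \<longlonglongrightarrow> C * norm x * 0"
          using \<rho> by (intro tendsto_intros LIMSEQ_power_zero) auto
        then have lim: "(\<lambda>m. C * norm x * \<rho> ^ m) \<longlonglongrightarrow> 0" by simp
        have "(\<lambda>m. F m x - S x) \<longlonglongrightarrow> 0"
        proof (rule Lim_null_comparison[OF _ lim])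
          have "norm (F m x - S x) \<le> C * norm x * \<rho> ^ m" for m
            using F(2)[of x m] by (simp add: norm_minus_commute mult_ac)
          then show "\<forall>\<^sub>F m in sequentially. norm (F m x - S x) \<le> C * norm x * \<rho> ^ m"
            by (rule always_eventually[OF allI])
        qed
        then show ?thesis by (rule Lim_null[THEN iffD2])
      qed
      ultimately show "(\<lambda>m. G m x) sums S x" by (simp add: sums_def_le)
    qed
    have "(\<lambda>i. norm (\<phi> i x *\<^sub>C snd i)) summable_on I"
      using bound snd_I \<open>L \<ge> 0\<close>
      by (intro summable_on_comparison_test[OF summable_on_cmult_left[OF cI, of "norm x"]])
        (auto simp: norm_scaleC)
    then show "(\<lambda>i. \<phi> i x *\<^sub>C snd i) summable_on Sigma UNIV A"
      unfolding I_def by (rule abs_summable_summable)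
  qed
  have "(\<lambda>i. c i * norm (snd i)) summable_on I"
    using cI by (rule summable_on_cong[THEN iffD1, rotated]) (simp add: snd_I)
  moreover have "c i \<ge> 0" for i using \<open>L \<ge> 0\<close> \<rho> by (simp add: c_def split: prod.splits)
  ultimately have "nuclear_expansion I \<phi> snd S"
    unfolding nuclear_expansion_def
    by (intro conjI exI[of _ c] ballI allI lin bound S_sum)
  then show ?thesis by blast
qed

text \<open>If \<open>N x = \<Sum>\<^sub>i \<phi>\<^sub>i(x) u\<^sub>i\<close>, then both operators have the trace \<open>\<Sum>\<^sub>i \<phi>\<^sub>i (S u\<^sub>i)\<close>.\<close>

lemma trace_commute:
  assumes "weak_order q N" "q > 1" "bounded_clinear S"
  shows "\<exists>t. has_trace (S \<circ> N) t \<and> has_trace (N \<circ> S) t"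
proof -
  obtain I :: "(nat \<times> 'a) set" and \<phi> u where N: "nuclear_expansion I \<phi> u N"
    using weak_order_nuclear_expansion[OF assms(1,2)] by blast
  obtain c where \<phi>: "\<And>i. i \<in> I \<Longrightarrow> clinear (\<phi> i)" "\<And>i. i \<in> I \<Longrightarrow> 0 \<le> c i"
      "\<And>i x. i \<in> I \<Longrightarrow> cmod (\<phi> i x) \<le> c i * norm x"
    and c: "(\<lambda>i. c i * norm (u i)) summable_on I"
    and sum: "\<And>x. ((\<lambda>i. \<phi> i x *\<^sub>C u i) has_sum N x) I"
    using N unfolding nuclear_expansion_def by blast
  obtain K where K: "K > 0" "\<And>x. norm (S x) \<le> K * norm x"
    using bounded_clinear_bound[OF assms(3)] by blast
  note bN = weak_orderD[OF assms(1)]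
  have cK: "(\<lambda>i. K * (c i * norm (u i))) summable_on I" by (rule summable_on_cmult_right[OF c])
  have "nuclear_expansion I \<phi> (\<lambda>i. S (u i)) (S \<circ> N)"
    unfolding nuclear_expansion_def
  proof (intro conjI exI[of _ c] ballI allI)
    show "(\<lambda>i. c i * norm (S (u i))) summable_on I"
    proof (rule summable_on_comparison_test[OF cK])
      fix i assume "i \<in> I"
      from mult_left_mono[OF K(2) \<phi>(2)[OF this], of "u i"]
      show "c i * norm (S (u i)) \<le> K * (c i * norm (u i))" by (simp add: mult_ac)
    qed (use \<phi>(2) in auto)
    show "((\<lambda>i. \<phi> i x *\<^sub>C S (u i)) has_sum (S \<circ> N) x) I" for x
      using has_sum_bounded_linear[OF bounded_clinear_bounded_linear[OF assms(3)] sum]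
      by (simp add: bounded_clinear_scaleC[OF assms(3)])
  qed (use \<phi> in auto)
  moreover have "nuclear_expansion I (\<lambda>i. \<phi> i \<circ> S) u (N \<circ> S)"
    unfolding nuclear_expansion_def
  proof (intro conjI exI[of _ "\<lambda>i. c i * K"] ballI allI)
    show "clinear (\<phi> i \<circ> S)" if "i \<in> I" for i
      using \<phi>(1)[OF that] by (simp add: clinear_iff bounded_clinear_simps[OF assms(3)])
    show "cmod ((\<phi> i \<circ> S) x) \<le> c i * K * norm x" if "i \<in> I" for i x
      using order.trans[OF \<phi>(3)[OF that] mult_left_mono[OF K(2) \<phi>(2)[OF that]]] by (simp add: mult_ac)
    show "(\<lambda>i. c i * K * norm (u i)) summable_on I" using cK by (simp add: mult_ac)
  qed (use \<phi> K sum in auto)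
  ultimately have "has_trace (S \<circ> N) (\<Sum>\<^sub>\<infinity>i\<in>I. \<phi> i (S (u i)))"
      "has_trace (N \<circ> S) (\<Sum>\<^sub>\<infinity>i\<in>I. \<phi> i (S (u i)))"
    using nuclear_expansion_has_sum bounded_clinear_compose[OF assms(3) bN] bounded_clinear_compose[OF bN assms(3)]
    unfolding has_trace_def by fastforce+
  then show ?thesis by blast
qed

section \<open>Approximation numbers of weak Schatten operators\<close>

lemma rank_le_proj:
  assumes "orthonormal A" "finite A"
  shows "rank_le (card A) (proj A)"
proof -
  have "bounded_clinear (proj A)"
    using norm_proj_le[OF assms]
    by (intro bounded_clinearI[where K = 1])
      (simp_all add: proj_def cinner_simps scaleC_add_left sum.distrib scaleC_scaleC
        complex_vector.scale_sum_right)
  then show ?thesis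
    unfolding rank_le_def using assms(2) proj_in_span by blast
qed

text \<open>For \<open>r = C * (m + 1) powr (- a)\<close> the term \<open>s m\<close> is at most
  \<open>r\<close>, so at most \<open>m\<close> singular values exceed \<open>r\<close>. The cutoff
  set at \<open>r\<close> then has at most \<open>m\<close> elements, and
  \<open>T \<circ> proj A\<close> approximates \<open>T\<close> within \<open>r\<close>.\<close>

lemma (in compact_symmetric) weak_order_weak_schatten:
  assumes "T \<in> weak_schatten p" "p > 0"
  shows "weak_order (1 / p) T"
proof -
  obtain s where s: "singular_values T s" "s \<in> O(\<lambda>k. real k powr (- 1 / p))"
    using assms(1) by (auto simp: weak_schatten_def)
  have "decseq s" using s(1) by (simp add: singular_values_def)
  define a where "a = 1 / p"
  have "a > 0" using assms(2) by (simp add: a_def)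
  \<comment> \<open>The shift to \<open>k + 1\<close> allows a bound at every index: at
    \<open>k = 0\<close> the unshifted power is 0 by convention.\<close>
  have "(\<lambda>k. real k powr (- a)) \<in> O(\<lambda>k. (real k + 1) powr (- a))"
  proof (rule bigoI)
    have "real k powr (- a) \<le> 2 powr a * (real k + 1) powr (- a)" if "k \<ge> 1" for k
    proof -
      have "real k powr (- a) \<le> ((real k + 1) / 2) powr (- a)"
        using that \<open>a > 0\<close> by (intro powr_mono2') auto
      then show ?thesis by (simp add: powr_divide powr_minus field_simps)
    qed
    then show "\<forall>\<^sub>F k in sequentially. norm (real k powr (- a)) \<le> 2 powr a * norm ((real k + 1) powr (- a))"
      by (intro eventually_sequentiallyI[of 1]) simp
  qed
  then have "s \<in> O(\<lambda>k. (real k + 1) powr (- a))"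
    using landau_o.big_trans[OF s(2)] by (simp add: a_def)
  then obtain c where "c > 0" and ev: "\<forall>\<^sub>F k in sequentially. norm (s k) \<le> c * norm ((real k + 1) powr (- a))"
    by (rule landau_o.bigE)
  from ev have "\<forall>\<^sub>F k in sequentially. norm (s k * (real k + 1) powr a) \<le> c"
    by eventually_elim (simp add: powr_minus field_simps abs_mult)
  \<comment> \<open>Boundedness of the sequence absorbs the finitely many indices missed by the
    eventual estimate, so that \<open>C\<close> serves all \<open>k\<close>.\<close>
  then have "Bseq (\<lambda>k. s k * (real k + 1) powr a)"
    using \<open>c > 0\<close> by (auto simp: Bfun_def)
  then obtain C where C: "C > 0" "\<And>k. norm (s k * (real k + 1) powr a) \<le> C"
    by (auto elim: BseqE)
  have le: "s k \<le> C * (real k + 1) powr (- a)" for k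
    using abs_le_D1[OF C(2)[of k, unfolded real_norm_def]] by (simp add: powr_minus field_simps)
  have "\<exists>F. rank_le (1 * m) F \<and> (\<forall>x. norm (T x - F x) \<le> C * (real m + 1) powr (- a) * norm x)" for m
  proof -
    define r where "r = C * (real m + 1) powr (- a)"
    have "r > 0" using C(1) by (simp add: r_def)
    obtain A where A: "finite A" "orthonormal A" "eigenvectors r A"
      and T_le: "\<And>x. (\<And>e. e \<in> A \<Longrightarrow> cinner e x = 0) \<Longrightarrow> norm (T x) \<le> r * norm x"
      using spectral_cutoff[OF \<open>r > 0\<close>] by blast
    have "{k. s k > r} \<subseteq> {..<m}"
    proof
      fix k assume "k \<in> {k. s k > r}"
      then have "s k > s m" using le[of m] by (simp add: r_def)
      then show "k \<in> {..<m}" using \<open>decseq s\<close> by (metis decseqD lessThan_iff linorder_not_less)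
    qed
    then have "card {k. s k > r} \<le> m" using card_mono[of "{..<m}"] by fastforce
    then have "card A \<le> m" using card_eigenvectors_le[OF A T_le \<open>r > 0\<close> s(1)] by simp
    then have "rank_le m (T \<circ> proj A)"
      using rank_le_compose_left[OF rank_le_proj[OF A(2,1)] bounded_clinear] rank_le_mono by blast
    moreover have "norm (T x - (T \<circ> proj A) x) \<le> r * norm x" for x
    proof -
      have "norm (T x - T (proj A x)) \<le> r * norm (x - proj A x)"
        unfolding T_simps[symmetric] using cinner_diff_proj[OF A(2,1)] by (intro T_le)
      also have "\<dots> \<le> r * norm x"
        using norm_diff_proj_le'[OF A(2,1)] \<open>r > 0\<close> by (intro mult_left_mono) auto
      finally show ?thesis by simp
    qed
    ultimately show ?thesis unfolding r_def by auto
  qed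
  then show ?thesis
    unfolding weak_order_def a_def using C(1) bounded_clinear
    by (intro conjI exI[of _ C] exI[of _ 1]) auto
qed

section \<open>Existence and linearity of the trace\<close>

lemma has_trace_weak_order:
  assumes "weak_order q S" "q > 1"
  shows "\<exists>t. has_trace S t"
  using trace_commute[OF assms bounded_clinear_id] by simp

lemma has_trace_add:
  assumes "has_trace S s" "has_trace T t"
  shows "has_trace (\<lambda>x. S x + T x) (s + t)"
  using assms bounded_clinear_plus unfolding has_trace_def
  by (auto simp: cinner_add_right intro: has_sum_add)

lemma has_trace_scale:
  assumes "has_trace S s"
  shows "has_trace (\<lambda>x. c *\<^sub>C S x) (c * s)"
  using assms bounded_clinear_scale unfolding has_trace_def
  by (auto simp: cinner_scaleC_right intro: has_sum_cmult_right)

lemma bounded_clinear_eq_on_dense: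
  assumes "bounded_clinear S" "bounded_clinear T" "closure X = UNIV" "\<And>x. x \<in> X \<Longrightarrow> S x = T x"
  shows "S = T"
proof
  fix x
  have "closed {x. S x = T x}"
    using assms(1,2)
    by (intro closed_Collect_eq linear_continuous_on bounded_clinear_bounded_linear)
  then have "closure X \<subseteq> {x. S x = T x}" using assms(4) by (intro closure_minimal) auto
  then show "S x = T x" using assms(3) by auto
qed

section \<open>The inverse of the Dirac operator\<close>

locale summable_sigma_triple = graded_sigma_spectral_triple \<sigma> \<pi> X D \<gamma>
  for \<sigma> :: "'a::complex_algebra \<Rightarrow> 'a" and \<pi> :: "'a \<Rightarrow> 'h::complex_hilbert \<Rightarrow> 'h"
    and X D \<gamma> +
  fixes n :: nat
  assumes even_n: "even n" and n_gt_1: "n > 1" and bij_D: "bij_betw D X UNIV"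
    and summable: "the_inv_into X D \<in> weak_schatten (real n)"
begin

definition T :: "'h \<Rightarrow> 'h" where "T = the_inv_into X D"

lemma T_in: "T y \<in> X" and D_T: "D (T y) = y"
  using bij_D unfolding T_def bij_betw_def
  by (auto intro: the_inv_into_into f_the_inv_into_f)

lemma T_D: "x \<in> X \<Longrightarrow> T (D x) = x"
  using bij_D unfolding T_def bij_betw_def by (auto intro: the_inv_into_f_f)

lemma X_dense: "closure X = UNIV"
  using selfadjoint by (simp add: selfadjoint_operator_def densely_defined_def)

lemma D_add: "x \<in> X \<Longrightarrow> y \<in> X \<Longrightarrow> D (x + y) = D x + D y"
  and D_scaleC: "x \<in> X \<Longrightarrow> D (c *\<^sub>C x) = c *\<^sub>C D x"
  using selfadjoint by (simp_all add: selfadjoint_operator_def densely_defined_def)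

sublocale T: compact_symmetric T
proof
  show "compact_operator T" using summable by (simp add: weak_schatten_def T_def)
  have "cinner (D x) y = cinner x (D y)" if "x \<in> X" "y \<in> X" for x y
    using selfadjoint that unfolding selfadjoint_operator_def by blast
  from this[OF T_in T_in] show "cinner (T x) y = cinner x (T y)" for x y by (simp add: D_T)
qed

lemma range_T: "range T = X"
  using T_in T_D by (metis image_subset_iff rangeI subsetI subset_antisym)

lemma weak_order_T: "weak_order (1 / n) T"
  using T.weak_order_weak_schatten[of "real n"] summable n_gt_1 by (simp add: T_def)

lemma eigenbasis: "\<exists>B. orthonormal_basis B \<and> (\<forall>e\<in>B. \<exists>l. T e = complex_of_real l *\<^sub>C e)"
  by (rule T.eigenbasis_exists) (simp add: range_T X_dense)

text \<open>\<open>has_trace\<close> quantifies over all orthonormal bases, so uniqueness depends on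
  having at least one; the eigenbasis of \<open>T\<close> serves.\<close>

lemma has_trace_unique:
  fixes S :: "'h \<Rightarrow> 'h"
  assumes "has_trace S s" "has_trace S t"
  shows "s = t"
proof -
  obtain B :: "'h set" where "orthonormal_basis B" using eigenbasis by blast
  then show ?thesis using assms has_sum_unique unfolding has_trace_def by blast
qed

lemma op_trace_eq: "has_trace S t \<Longrightarrow> op_trace S = t" for S :: "'h \<Rightarrow> 'h"
  unfolding op_trace_def using has_trace_unique by blast

lemma has_trace_op_trace:
  fixes S :: "'h \<Rightarrow> 'h"
  assumes "weak_order q S" "q > 1"
  shows "has_trace S (op_trace S)"
  using has_trace_weak_order[OF assms] op_trace_eq by blast

text \<open>In an eigenbasis of \<open>T\<close> the two diagonals coincide.\<close>

lemma has_trace_T_commute: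
  assumes S: "bounded_clinear S" and "has_trace (T \<circ> S) s" "has_trace (S \<circ> T) t"
  shows "s = t"
proof -
  obtain B where B: "orthonormal_basis B" "\<And>e. e \<in> B \<Longrightarrow> \<exists>l. T e = complex_of_real l *\<^sub>C e"
    using eigenbasis by blast
  have "cinner e ((T \<circ> S) e) = cinner e ((S \<circ> T) e)" if e: "e \<in> B" for e
  proof -
    obtain l where l: "T e = complex_of_real l *\<^sub>C e" using B(2)[OF e] by blast
    have "cinner e (T (S e)) = cinner (T e) (S e)" by (simp add: T.symmetric)
    then show ?thesis by (simp add: l cinner_simps bounded_clinear_scaleC[OF S])
  qed
  moreover have "((\<lambda>e. cinner e ((T \<circ> S) e)) has_sum s) B"
    using assms(2) B(1) unfolding has_trace_def by blast
  ultimately have "((\<lambda>e. cinner e ((S \<circ> T) e)) has_sum s) B"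
    by (rule has_sum_cong[THEN iffD1])
  then show ?thesis using assms(3) B(1) has_sum_unique unfolding has_trace_def by blast
qed

section \<open>Twisted commutators\<close>

lemma \<pi>_bounded: "bounded_clinear (\<pi> a)"
  and \<pi>_add: "\<pi> (a + b) x = \<pi> a x + \<pi> b x"
  and \<pi>_scaleC: "\<pi> (c *\<^sub>C a) x = c *\<^sub>C \<pi> a x"
  and \<pi>_mult: "\<pi> (a * b) x = \<pi> a (\<pi> b x)"
  using action by (simp_all add: algebra_action_def)

lemma \<sigma>_add: "\<sigma> (a + b) = \<sigma> a + \<sigma> b"
  and \<sigma>_scaleC: "\<sigma> (c *\<^sub>C a) = c *\<^sub>C \<sigma> a"
  and \<sigma>_mult: "\<sigma> (a * b) = \<sigma> a * \<sigma> b"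
  using automorphism by (simp_all add: algebra_automorphism_def clinear_iff)

definition d :: "'a \<Rightarrow> 'h \<Rightarrow> 'h" where "d a = d_sigma \<sigma> \<pi> X D a"

text \<open>A bounded extension from the dense domain is unique, so the definite description in
  \<open>d_sigma\<close> becomes an equation to be checked on \<open>X\<close>.\<close>

lemma d_eqI:
  assumes "bounded_clinear S" "\<And>x. x \<in> X \<Longrightarrow> S x = D (\<pi> a x) - \<pi> (\<sigma> a) (D x)"
  shows "d a = S"
  unfolding d_def d_sigma_def
proof (rule the_equality)
  fix S' assume "twisted_commutator_ext \<sigma> \<pi> X D a S'"
  then show "S' = S"
    using assms by (intro bounded_clinear_eq_on_dense[OF _ assms(1) X_dense])
      (auto simp: twisted_commutator_ext_def)
qed (use assms in \<open>simp add: twisted_commutator_ext_def\<close>)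

lemma d_bounded: "bounded_clinear (d a)"
  and d_eq: "x \<in> X \<Longrightarrow> d a x = D (\<pi> a x) - \<pi> (\<sigma> a) (D x)"
proof -
  obtain S where "bounded_clinear S" "\<And>x. x \<in> X \<Longrightarrow> S x = D (\<pi> a x) - \<pi> (\<sigma> a) (D x)"
    using bounded_twisted_commutator[of a] by (auto simp: twisted_commutator_ext_def)
  then show "bounded_clinear (d a)" "x \<in> X \<Longrightarrow> d a x = D (\<pi> a x) - \<pi> (\<sigma> a) (D x)"
    using d_eqI by simp_all
qed

lemma d_add: "d (a + b) = (\<lambda>x. d a x + d b x)"
  by (rule d_eqI) (simp_all add: bounded_clinear_plus d_bounded d_eq \<sigma>_add \<pi>_add D_add preserves_domain)

lemma d_scaleC: "d (c *\<^sub>C a) = (\<lambda>x. c *\<^sub>C d a x)"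
  by (rule d_eqI)
    (simp_all add: bounded_clinear_scale d_bounded d_eq \<sigma>_scaleC \<pi>_scaleC D_scaleC preserves_domain
      complex_vector.scale_right_diff_distrib)

text \<open>On the domain, insert \<open>\<pi> (\<sigma> a) D (\<pi> b x)\<close> with both
  signs.\<close>

lemma d_mult: "d (a * b) = (\<lambda>x. (d a \<circ> \<pi> b) x + (\<pi> (\<sigma> a) \<circ> d b) x)"
  by (rule d_eqI)
    (intro bounded_clinear_plus bounded_clinear_compose d_bounded \<pi>_bounded,
     simp add: d_eq \<sigma>_mult \<pi>_mult preserves_domain bounded_clinear_diff[OF \<pi>_bounded])

section \<open>The derivation given by the inverse of the Dirac operator times the twisted
  commutator\<close>

definition Q :: "'a \<Rightarrow> 'h \<Rightarrow> 'h" where "Q a = T \<circ> d a"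

text \<open>The bounded extension of \<open>D\<^sup>-\<^sup>1 \<sigma>(a) D\<close>. Hence \<open>D\<^sup>-\<^sup>1 d\<^sub>\<sigma>a = \<pi>(a) - \<rho>(a)\<close> is a
  difference of two representations, which makes it a derivation.\<close>

definition \<rho> :: "'a \<Rightarrow> 'h \<Rightarrow> 'h" where "\<rho> a = (\<lambda>x. \<pi> a x - Q a x)"

lemma Q_bounded: "bounded_clinear (Q a)"
  unfolding Q_def by (intro bounded_clinear_compose T.bounded_clinear d_bounded)

lemma \<rho>_bounded: "bounded_clinear (\<rho> a)"
  unfolding \<rho>_def by (intro bounded_clinear_minus_op \<pi>_bounded Q_bounded)

lemma \<rho>_T: "\<rho> a (T y) = T (\<pi> (\<sigma> a) y)"
  by (simp add: \<rho>_def Q_def d_eq T_in D_T T.T_simps T_D preserves_domain)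

lemma Q_add: "Q (a + b) = (\<lambda>x. Q a x + Q b x)"
  by (auto simp: Q_def d_add T.T_simps)

lemma Q_scaleC: "Q (c *\<^sub>C a) = (\<lambda>x. c *\<^sub>C Q a x)"
  by (auto simp: Q_def d_scaleC T.T_simps)

text \<open>Apply \<open>T\<close> to the twisted product rule; \<open>\<rho>_T\<close> moves
  \<open>T\<close> past \<open>\<pi> (\<sigma> a)\<close>, turning it into
  \<open>\<rho> a\<close>.\<close>

lemma Q_mult: "Q (a * b) = (\<lambda>x. (Q a \<circ> \<pi> b) x + (\<rho> a \<circ> Q b) x)"
  by (auto simp: Q_def d_mult T.T_simps \<rho>_T[unfolded Q_def] simp flip: \<rho>_T)

lemma \<gamma>_T: "\<gamma> (T y) = - T (\<gamma> y)"
proof -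
  have "D (\<gamma> (T y)) = - \<gamma> y" by (simp add: grading_anticommutes T_in D_T)
  then have "\<gamma> (T y) = T (- \<gamma> y)" using T_D grading_domain T_in by metis
  then show ?thesis by (simp add: T.T_simps)
qed

text \<open>On the domain both terms of the twisted commutator contain \<open>D\<close> once and
  change sign; density extends the identity.\<close>

lemma \<gamma>_d: "\<gamma> (d a x) = - d a (\<gamma> x)"
proof -
  have eq: "\<gamma> (d a x) = - d a (\<gamma> x)" if "x \<in> X" for x
    using that by (simp add: d_eq grading_domain grading_commutes grading_anticommutes preserves_domain
      bounded_clinear_simps[OF grading_bounded] bounded_clinear_simps[OF \<pi>_bounded]
      flip: grading_commutes)
  have "bounded_clinear (\<lambda>x. - d a (\<gamma> x))"
    using bounded_clinear_minus_op[OF bounded_clinear_0 bounded_clinear_compose[OF d_bounded grading_bounded]]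
    by simp
  from bounded_clinear_eq_on_dense[OF bounded_clinear_compose[OF grading_bounded d_bounded] this X_dense, of a]
  have "\<gamma> \<circ> d a = (\<lambda>x. - d a (\<gamma> x))" using eq by simp
  then show ?thesis by (metis comp_apply)
qed

text \<open>The signs from \<open>T\<close> and from \<open>d a\<close> cancel.\<close>

lemma \<gamma>_Q: "\<gamma> \<circ> Q a = Q a \<circ> \<gamma>"
  by (auto simp: Q_def \<gamma>_T \<gamma>_d T.T_simps)

lemma \<gamma>_\<pi>: "\<gamma> \<circ> \<pi> a = \<pi> a \<circ> \<gamma>"
  by (auto simp: grading_commutes)

section \<open>Traces of words\<close>

definition P :: "'a list \<Rightarrow> 'h \<Rightarrow> 'h" where "P as = foldr (\<lambda>a S. Q a \<circ> S) as id"

lemma P_Nil: "P [] = id" and P_Cons: "P (a # as) = Q a \<circ> P as"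
  by (simp_all add: P_def)

lemma P_append: "P (as @ bs) = P as \<circ> P bs"
  by (induction as) (simp_all add: P_Nil P_Cons comp_assoc)

lemma character_operator_eq: "character_operator \<sigma> \<pi> X D \<gamma> as = \<gamma> \<circ> P as"
  by (simp add: character_operator_def P_def Q_def T_def d_def)

lemma weak_order_Q: "weak_order (1 / n) (Q a)"
  using weak_order_compose[OF weak_order_T weak_order_0[OF d_bounded]] by (simp add: Q_def)

text \<open>Each letter contributes \<open>1 / n\<close>, so words of more than \<open>n\<close>
  letters have order greater than 1 and thus a trace.\<close>

lemma weak_order_P: "weak_order (length as / n) (P as)"
proof (induction as)
  case Nil
  show ?case unfolding P_Nil list.size of_nat_0 div_0 by (rule weak_order_0[OF bounded_clinear_id])
next
  case (Cons a as)
  then show ?case using weak_order_compose[OF weak_order_Q Cons, of a]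
    unfolding P_Cons by (simp only: length_Cons of_nat_Suc add_divide_distrib)
qed

text \<open>The product rule produces words with a factor \<open>\<pi> a\<close> or
  \<open>\<rho> a\<close> among the factors \<open>Q\<close>; \<open>S\<close> is the place for such
  a factor.\<close>

definition slot :: "'a list \<Rightarrow> ('h \<Rightarrow> 'h) \<Rightarrow> 'a list \<Rightarrow> complex" where
  "slot as S bs = op_trace (\<gamma> \<circ> P as \<circ> S \<circ> P bs)"

lemma has_trace_slot:
  assumes "weak_order q S" "q + (length as + length bs) / n > 1"
  shows "has_trace (\<gamma> \<circ> P as \<circ> S \<circ> P bs) (slot as S bs)"
  unfolding slot_def
proof (rule has_trace_op_trace)
  show "weak_order (0 + length as / n + q + length bs / n) (\<gamma> \<circ> P as \<circ> S \<circ> P bs)"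
    by (intro weak_order_compose weak_order_P weak_order_0 grading_bounded assms(1))
qed (use assms(2) in \<open>simp add: add_divide_distrib\<close>)

lemma linear_slot:
  "(\<gamma> \<circ> P as \<circ> (\<lambda>x. R x + S x) \<circ> P bs) = (\<lambda>x. (\<gamma> \<circ> P as \<circ> R \<circ> P bs) x + (\<gamma> \<circ> P as \<circ> S \<circ> P bs) x)"
  "(\<gamma> \<circ> P as \<circ> (\<lambda>x. c *\<^sub>C S x) \<circ> P bs) = (\<lambda>x. c *\<^sub>C (\<gamma> \<circ> P as \<circ> S \<circ> P bs) x)"
  by (auto simp: bounded_clinear_simps[OF grading_bounded] bounded_clinear_simps[OF weak_orderD[OF weak_order_P]])

lemma slot_add:
  assumes "weak_order q R" "weak_order q S" "q + (length as + length bs) / n > 1"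
  shows "slot as (\<lambda>x. R x + S x) bs = slot as R bs + slot as S bs"
  using op_trace_eq[OF has_trace_add[OF has_trace_slot[OF assms(1,3)] has_trace_slot[OF assms(2,3)]]]
  unfolding slot_def[of as "\<lambda>x. R x + S x"] linear_slot .

lemma slot_scaleC:
  assumes "weak_order q S" "q + (length as + length bs) / n > 1"
  shows "slot as (\<lambda>x. c *\<^sub>C S x) bs = c * slot as S bs"
  using op_trace_eq[OF has_trace_scale[OF has_trace_slot[OF assms]]]
  unfolding slot_def[of as "\<lambda>x. c *\<^sub>C S x"] linear_slot .

lemma slot_comp_left: "slot as (Q a \<circ> S) bs = slot (as @ [a]) S bs"
  by (simp add: slot_def P_append P_Cons P_Nil comp_assoc)

lemma slot_comp_right: "slot as (S \<circ> Q a) bs = slot as S (a # bs)"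
  by (simp add: slot_def P_Cons comp_assoc)

abbreviation \<Phi> :: "'a list \<Rightarrow> complex" where "\<Phi> \<equiv> Phi_D_sigma \<sigma> \<pi> X D \<gamma>"

lemma \<Phi>_eq: "\<Phi> as = op_trace (\<gamma> \<circ> P as)"
  by (simp add: Phi_D_sigma_def character_operator_eq)

lemma \<Phi>_slot: "\<Phi> (as @ a # bs) = slot as (Q a) bs"
  by (simp add: slot_def \<Phi>_eq P_append P_Cons comp_assoc)

lemma has_trace_\<Phi>:
  assumes "length as > n"
  shows "has_trace (\<gamma> \<circ> P as) (\<Phi> as)"
proof -
  have "0 + length as / n > 1" using assms n_gt_1 by simp
  from has_trace_op_trace[OF weak_order_compose[OF weak_order_0[OF grading_bounded] weak_order_P] this]
  show ?thesis by (simp add: \<Phi>_eq)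
qed

text \<open>The factor \<open>d a\<close> is moved around the trace class operator \<open>\<gamma> \<circ> S \<circ> T\<close>, and then \<open>T\<close>
  around a product that need not be trace class.\<close>

lemma trace_cycle:
  assumes "weak_order q S" "q \<ge> 1"
  shows "op_trace (\<gamma> \<circ> Q a \<circ> S) = op_trace (\<gamma> \<circ> S \<circ> Q a)"
proof -
  \<comment> \<open>\<open>S\<close> has order at least 1 and the factor \<open>T\<close> inside
    \<open>Q a\<close> adds \<open>1 / n\<close>.\<close>
  have pos: "0 + q + 1 / n > 1" using assms(2) n_gt_1 add_le_less_mono[of 1 q 0 "1 / real n"] by simp
  have "weak_order (0 + q + 1 / n) (\<gamma> \<circ> S \<circ> T)"
    by (intro weak_order_compose weak_order_0 grading_bounded assms(1) weak_order_T)
  from trace_commute[OF this pos d_bounded[of a]] obtain t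
    where t: "has_trace (d a \<circ> (\<gamma> \<circ> S \<circ> T)) t" "has_trace (\<gamma> \<circ> S \<circ> T \<circ> d a) t" by blast
  have "weak_order (0 + q + 1 / n) (T \<circ> (d a \<circ> \<gamma> \<circ> S))"
    using weak_order_compose[OF weak_order_T weak_order_compose[OF weak_order_compose[OF
        weak_order_0[OF d_bounded[of a]] weak_order_0[OF grading_bounded]] assms(1)]]
    by (simp add: add.commute)
  moreover have bS: "bounded_clinear (d a \<circ> \<gamma> \<circ> S)"
    by (intro bounded_clinear_compose d_bounded grading_bounded weak_orderD[OF assms(1)])
  ultimately have 1: "has_trace (T \<circ> (d a \<circ> \<gamma> \<circ> S)) (op_trace (T \<circ> (d a \<circ> \<gamma> \<circ> S)))"
    using pos by (intro has_trace_op_trace)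
  have "has_trace ((d a \<circ> \<gamma> \<circ> S) \<circ> T) t" using t(1) by (simp add: comp_assoc)
  from has_trace_T_commute[OF bS 1 this] have "op_trace (T \<circ> (d a \<circ> \<gamma> \<circ> S)) = t" .
  \<comment> \<open>Once \<open>T\<close> has joined \<open>d a\<close> to form \<open>Q a\<close>,
    the grading commutes past it to the front.\<close>
  moreover have "T \<circ> (d a \<circ> \<gamma> \<circ> S) = \<gamma> \<circ> Q a \<circ> S" unfolding \<gamma>_Q by (simp add: Q_def comp_assoc)
  moreover have "op_trace (\<gamma> \<circ> S \<circ> Q a) = t" using op_trace_eq[OF t(2)] by (simp add: Q_def comp_assoc)
  ultimately show ?thesis by simp
qed

lemma \<Phi>_cyclic:
  assumes "length as \<ge> n"
  shows "\<Phi> (a # as) = \<Phi> (as @ [a])"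
proof -
  have "length as / n \<ge> 1" using assms n_gt_1 by simp
  from trace_cycle[OF weak_order_P this, of a] show ?thesis
    by (simp add: \<Phi>_eq P_Cons P_append P_Nil comp_assoc)
qed

text \<open>\<open>trace_cycle\<close> applies to \<open>S \<circ> P as\<close>: the bounded factor
  \<open>S\<close> has order 0, and the letters of \<open>as\<close> already give order at least
  1.\<close>

lemma slot_cyclic:
  assumes "length as \<ge> n" "bounded_clinear S"
  shows "slot [a] S as = slot [] S (as @ [a])"
proof -
  have "0 + length as / n \<ge> 1" using assms n_gt_1 by simp
  from trace_cycle[OF weak_order_compose[OF weak_order_0[OF assms(2)] weak_order_P] this, of a]
  show ?thesis
    by (simp add: slot_def P_Cons P_append P_Nil comp_assoc)
qed

text \<open>The bounded factor \<open>\<pi> a\<close> moves around the trace class operator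
  \<open>\<gamma> \<circ> P as\<close> and then commutes with \<open>\<gamma>\<close>.\<close>

lemma slot_rotate:
  assumes "length as > n"
  shows "slot as (\<pi> a) [] = slot [] (\<pi> a) as"
proof -
  have "0 + length as / n > 1" using assms n_gt_1 by simp
  from trace_commute[OF weak_order_compose[OF weak_order_0[OF grading_bounded] weak_order_P] this \<pi>_bounded]
  obtain t where "has_trace (\<pi> a \<circ> (\<gamma> \<circ> P as)) t" "has_trace (\<gamma> \<circ> P as \<circ> \<pi> a) t" by blast
  moreover have "\<pi> a \<circ> (\<gamma> \<circ> P as) = \<gamma> \<circ> \<pi> a \<circ> P as" unfolding \<gamma>_\<pi> by (simp add: comp_assoc)
  ultimately show ?thesis by (simp add: slot_def P_Nil op_trace_eq)
qed

section \<open>The cocycle\<close>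

lemma \<Phi>_multilinear: "multilinear_form (n + 1) \<Phi>"
  unfolding multilinear_form_def clinear_iff
proof (intro allI impI conjI)
  fix as :: "'a list" and i assume as: "length as = n + 1 \<and> i < n + 1"
  have upd: "\<Phi> (as[i := x]) = slot (take i as) (Q x) (drop (Suc i) as)" for x
    using as by (simp add: upd_conv_take_nth_drop \<Phi>_slot)
  have "real (length (take i as) + length (drop (Suc i) as)) = n" using as by simp
  then have pos: "1 / n + (length (take i as) + length (drop (Suc i) as)) / n > 1"
    using n_gt_1 by (simp only:) simp
  show "\<Phi> (as[i := x + y]) = \<Phi> (as[i := x]) + \<Phi> (as[i := y])" for x y
    unfolding upd Q_add by (rule slot_add[OF weak_order_Q weak_order_Q pos])
  show "\<Phi> (as[i := c *\<^sub>C x]) = c *\<^sub>C \<Phi> (as[i := x])" for c x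
    unfolding upd Q_scaleC scaleC_complex_eq by (rule slot_scaleC[OF weak_order_Q pos])
qed

text \<open>Split \<open>\<pi> a\<close> as \<open>\<rho> a + Q a\<close>. Since
  \<open>\<rho> a\<close> has only order 0, the more than \<open>n\<close> remaining letters must
  supply the trace class property.\<close>

lemma slot_\<pi>:
  assumes "length as + length bs > n"
  shows "slot as (\<pi> a) bs = slot as (\<rho> a) bs + \<Phi> (as @ a # bs)"
proof -
  have pos: "0 + (length as + length bs) / n > 1" using assms n_gt_1 by simp
  have "\<pi> a = (\<lambda>x. \<rho> a x + Q a x)" by (simp add: \<rho>_def)
  then have "slot as (\<pi> a) bs = slot as (\<lambda>x. \<rho> a x + Q a x) bs" by simp
  then show ?thesis
    using slot_add[OF weak_order_0[OF \<rho>_bounded] weak_order_0[OF Q_bounded] pos] by (simp add: \<Phi>_slot)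
qed

text \<open>Each of the two terms of \<open>Q_mult\<close> retains \<open>n + 1\<close> factors
  \<open>Q\<close>, so the trace can be split.\<close>

lemma \<Phi>_mult:
  assumes "length as + length bs = n"
  shows "\<Phi> (as @ (a * b) # bs) = slot (as @ [a]) (\<pi> b) bs + slot as (\<rho> a) (b # bs)"
proof -
  have pos: "1 / n + (length as + length bs) / n > 1" using assms n_gt_1 by simp
  have "weak_order (1 / n) (Q a \<circ> \<pi> b)" "weak_order (1 / n) (\<rho> a \<circ> Q b)"
    using weak_order_compose[OF weak_order_Q weak_order_0[OF \<pi>_bounded]]
      weak_order_compose[OF weak_order_0[OF \<rho>_bounded] weak_order_Q] by simp_all
  from slot_add[OF this pos] show ?thesis
    by (simp add: \<Phi>_slot Q_mult slot_comp_left slot_comp_right)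
qed

text \<open>Let \<open>f i\<close> and \<open>g i\<close> be the traces with letter \<open>i\<close>
  replaced by its \<open>\<pi>\<close> or its \<open>\<rho>\<close>; they differ by the trace
  \<open>W\<close> of the full word. Each term of the coboundary is \<open>W\<close> plus two
  cyclically adjacent values of \<open>g\<close>. For even \<open>n\<close> the alternating sum
  collapses to \<open>W + g 0 + g (n + 1)\<close>, which the last term cancels.\<close>

lemma \<Phi>_hochschild:
  assumes len: "length as = n + 2"
  shows "hochschild_b n \<Phi> as = 0"
proof -
  define W where "W = \<Phi> as"
  define f where "f i = slot (take i as) (\<pi> (as ! i)) (drop (Suc i) as)" for i
  define g where "g i = slot (take i as) (\<rho> (as ! i)) (drop (Suc i) as)" for i
  have fg: "f i = g i + W" if "i < n + 2" for i
    using that slot_\<pi>[of "take i as" "drop (Suc i) as" "as ! i"] len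
    by (simp add: f_def g_def W_def id_take_nth_drop[symmetric])
  have inner: "\<Phi> (take i as @ [as ! i * as ! (i + 1)] @ drop (i + 2) as) = W + (g i + g (Suc i))"
    if "i \<le> n" for i
  proof -
    have "\<Phi> (take i as @ (as ! i * as ! Suc i) # drop (Suc (Suc i)) as) = f (Suc i) + g i"
      using that len \<Phi>_mult[of "take i as" "drop (Suc (Suc i)) as" "as ! i" "as ! Suc i"]
      by (simp add: f_def g_def take_Suc_conv_app_nth Cons_nth_drop_Suc)
    then show ?thesis using fg[of "Suc i"] that by simp
  qed
  define bs where "bs = take n (tl as)"
  have as: "as = as ! 0 # bs @ [as ! (n + 1)]"
  proof -
    have "tl as = bs @ [as ! (n + 1)]"
      using len take_Suc_conv_app_nth[of n "tl as"] by (simp add: bs_def nth_tl)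
    moreover have "as = as ! 0 # tl as" using len by (cases as) auto
    ultimately show ?thesis by simp
  qed
  have len_bs: "length bs = n" using len by (simp add: bs_def)
  \<comment> \<open>The last letter is rotated to the front, where the wrap-around product needs
    it.\<close>
  have f0: "f 0 = slot [as ! (n + 1)] (\<pi> (as ! 0)) bs"
  proof -
    have "drop (Suc 0) as = bs @ [as ! (n + 1)]" by (subst as) simp
    then show ?thesis using slot_cyclic[of bs, OF _ \<pi>_bounded] len_bs by (simp add: f_def)
  qed
  \<comment> \<open>Here \<open>\<pi>\<close> of the last letter is itself rotated to the front and
    only then exchanged for \<open>\<rho>\<close>; the resulting full word is a rotation of
    \<open>as\<close>, with trace \<open>W\<close>.\<close>
  have fn: "f (n + 1) = slot [] (\<rho> (as ! (n + 1))) (as ! 0 # bs) + W"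
  proof -
    have "take (Suc n) as = as ! 0 # bs"
      by (subst as) (simp add: len_bs)
    then have "f (n + 1) = slot [] (\<pi> (as ! (n + 1))) (as ! 0 # bs)"
      using slot_rotate[of "as ! 0 # bs"] len len_bs by (simp add: f_def)
    moreover have "\<Phi> (as ! (n + 1) # as ! 0 # bs) = W"
      using \<Phi>_cyclic[of "as ! 0 # bs" "as ! (n + 1)"] len_bs as by (simp add: W_def)
    ultimately show ?thesis using slot_\<pi>[of "[]" "as ! 0 # bs" "as ! (n + 1)"] len_bs by simp
  qed
  \<comment> \<open>The product rule gives \<open>f 0\<close> plus \<open>f (n + 1) - W\<close>, and
    each \<open>f\<close> exceeds its \<open>g\<close> by \<open>W\<close>.\<close>
  have last: "\<Phi> ([as ! (n + 1) * as ! 0] @ take n (tl as)) = W + (g 0 + g (n + 1))"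
    using \<Phi>_mult[of "[]" bs "as ! (n + 1)" "as ! 0"] len_bs f0 fn fg[of 0] fg[of "n + 1"]
    unfolding bs_def[symmetric] by (simp add: add.commute)
  have telescope: "(\<Sum>i=0..m. (-1) ^ i * (W + (g i + g (Suc i)))) = (if even m then W else 0) + (g 0 + (-1) ^ m * g (Suc m))" for m
    by (induction m) (auto simp: algebra_simps)
  have "(\<Sum>i=0..n. (-1) ^ i * \<Phi> (take i as @ [as ! i * as ! (i + 1)] @ drop (i + 2) as))
      = (\<Sum>i=0..n. (-1) ^ i * (W + (g i + g (Suc i))))"
    using inner by (intro sum.cong) simp_all
  then show ?thesis
    unfolding hochschild_b_def last telescope using even_n by simp
qed

lemma \<Phi>_cyclic_cocycle: "\<Phi> \<in> cyclic_cocycles n"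
proof -
  have "\<Phi> (last as # butlast as) = (-1) ^ n * \<Phi> as" if "length as = n + 1" for as
    using \<Phi>_cyclic[of "butlast as" "last as"] that even_n by (cases as rule: rev_cases) simp_all
  then show ?thesis
    using \<Phi>_multilinear \<Phi>_hochschild by (simp add: cyclic_cocycles_def)
qed

end

text \<open>\<open>op_trace\<close> is a definite description, so the first conjunct records that
  the trace in question exists for every tuple.\<close>

theorem proposition3p5:
  fixes \<sigma> :: "'a::complex_algebra \<Rightarrow> 'a"
    and \<pi> :: "'a \<Rightarrow> 'h::complex_hilbert \<Rightarrow> 'h"
    and X :: "'h set" and D :: "'h \<Rightarrow> 'h" and \<gamma> :: "'h \<Rightarrow> 'h" and n :: nat
  assumes "graded_sigma_spectral_triple \<sigma> \<pi> X D \<gamma>"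
    and "even n" and "n > 1"
    and "bij_betw D X UNIV"
    and "the_inv_into X D \<in> weak_schatten (real n)"
  shows "(\<forall>as. length as = n + 1 \<longrightarrow>
            has_trace (character_operator \<sigma> \<pi> X D \<gamma> as) (Phi_D_sigma \<sigma> \<pi> X D \<gamma> as)) \<and>
         Phi_D_sigma \<sigma> \<pi> X D \<gamma> \<in> cyclic_cocycles n"
proof -
  interpret summable_sigma_triple \<sigma> \<pi> X D \<gamma> n
    using assms by (simp add: summable_sigma_triple_def summable_sigma_triple_axioms_def)
  show ?thesis
    using has_trace_\<Phi> \<Phi>_cyclic_cocycle by (simp add: character_operator_eq)
qed

end
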